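(* There exists an absolute constant $c>0$ with the following property. Let $A>0$ be fixed. Uniformly for real $x,y$ and integers $k\ge 0$ satisfying $$3\le y\le x^{c(\log_3 x)/\log_2 x},\qquad r:=\frac{k}{\log_2 y}\le A,$$ we have $$N_k(x,y)=F(r)\,e^{\gamma(r-1)}\,\frac{x(\log_2 y)^k}{k!\,\log y}\Big\{1+O\Big(\frac{k}{(\log_2 y)^2}\Big)\Big\},$$ where the implied constant depends at most on $A$.
   Context: $\log_j$ denotes the $j$-th iterated logarithm ($\log_2 x=\log\log x$, $\log_3 x=\log\log\log x$), and $x$ is assumed large enough that these are defined and positive. For $n\in\mathbb{N}$ and $y\ge 2$, $\nu(n,y):=\sum_{p\mid n,\,p\le y}1$ is the number of distinct prime factors of $n$ not exceeding $y$. For $x\ge y\ge 2$ and integer $k\ge0$, $N_k(x,y):=\#\{n\le x:\nu(n,y)=k\}$. $\gamma$ is Euler's constant. For complex $z$, $F(z):=\prod_p\big(1+\frac{z}{p-1}\big)\big(1-\frac1p\big)^z$, the product over all primes $p$.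
   Formalization: The error term is O(max(1,k)/(log_2 y)^2) instead of O(k/(log_2 y)^2); for k ≥ 1 they agree, while for k = 0 the printed term would force the exact identity N_0(x,y) = e^{-γ}x/log y, which is false (e.g. y = 3, where N_0 ~ x/3). *)

theory Defs
  imports "HOL-Analysis.Analysis" "HOL-Computational_Algebra.Primes"
begin

definition iter_ln :: "nat \<Rightarrow> real \<Rightarrow> real" where
  "iter_ln j x = (ln ^^ j) x"

definition nu :: "nat \<Rightarrow> real \<Rightarrow> nat" where
  "nu n y = card {p::nat. prime p \<and> p dvd n \<and> real p \<le> y}"

definition N_count :: "nat \<Rightarrow> real \<Rightarrow> real \<Rightarrow> nat" where
  "N_count k x y = card {n::nat. 1 \<le> n \<and> real n \<le> x \<and> nu n y = k}"

(* The product over the primes is an infinite product over all naturals in increasing order,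
   with factor 1 at the non-primes.  The predicate has_prod, and hence prodinf, tolerates
   finitely many vanishing factors, so F takes the value 0 at z = 1 - p as it should. *)
definition F :: "complex \<Rightarrow> complex" where
  "F z = prodinf (\<lambda>p::nat. if prime p
           then (1 + z / (of_nat p - 1)) * (1 - 1 / of_nat p) powr z else 1)"

end

theory Submission
  imports Defs "HOL-Computational_Algebra.Polynomial_FPS" "HOL-Real_Asymp.Real_Asymp"
begin

text \<open>
  Write \<open>L = ln ln y\<close> and \<open>r = k / L\<close>. Expanding \<open>z\<^bsup>\<nu>(n,y)\<^esup>\<close> as a sum of
  \<open>(z - 1)\<^bsup>\<omega>(d)\<^esup>\<close> over squarefree \<open>d\<close> dividing \<open>n\<close> with all prime factors at most \<open>y\<close>,
  the coefficient of \<open>z\<^sup>k\<close> in the sum over \<open>n \<le> x\<close> becomes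
  \<open>x \<Prod>(1 - 1/p)\<close> times the coefficient of \<open>z\<^sup>k\<close> in \<open>\<Prod>(1 + z/(p - 1))\<close>, where \<open>p\<close> runs over
  the primes up to \<open>y\<close>. Since \<open>(z - 1)\<^sup>m\<close> has coefficients at most \<open>(1 + r)\<^sup>m r\<^bsup>-k\<^esup>\<close>, Rankin's
  trick bounds the rounding error, and the loss against the main term is a power of \<open>ln y\<close> that does
  not depend on \<open>A\<close>; this is why the constant \<open>c\<close> can be absolute.

  For the main term, \<open>\<Prod>(1 + z/(p - 1)) = e\<^bsup>Lz\<^esup> G(z)\<close> where the Taylor coefficients of \<open>G\<close> are
  bounded uniformly in \<open>y\<close> in a weighted \<open>\<ell>\<^sup>1\<close> norm. The coefficient of \<open>z\<^sup>k\<close> is \<open>L\<^sup>k/k!\<close> times the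
  sum of \<open>g\<^sub>j k(k-1)...(k-j+1)/L\<^sup>j\<close>, and replacing the falling factorials by \<open>k\<^sup>j\<close> turns the sum into
  \<open>G(r)\<close> at the cost of \<open>O(k/L\<^sup>2)\<close>. Mertens' third theorem, with Euler's constant, evaluates
  \<open>G(r)\<close> and \<open>\<Prod>(1 - 1/p)\<close>.
\<close>

section \<open>The sieve identity and its error term\<close>

text \<open>Rankin's trick leaves the factor e^((1+r)L) r^(-k). As rL = k, this is e^L times e^k
  L^k/k^k, and by a weak Stirling bound e^k/k^k is at most e max(1,k)/k!. So against L^k/k! only e^L
  = ln y and max(1,k) are lost, whatever r is. The other loss is exp((1+r) K (1 + \<alpha>
  e^\<alpha>)); the choice \<alpha> = (ln L)/2 makes it at most e^L once L exceeds a threshold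
  depending on A. The saving e^(-\<alpha> u), with u = ln x/ln y at least 20 L/ln L, is e^(-10 L),
  which leaves ample room and explains the choice c = 1/20. Below the threshold k and L are bounded
  and the claim is a trivial estimate. Coefficients are estimated in a submultiplicative norm on
  power series instead of by contour integrals, so only real r \<ge> 0 occur; there F is positive
  and can be handled through its logarithm. Mertens' theorem brings in a relative error 1/ln y that
  does not vanish at k = 0. This is why max(1,k) stands in the error term.\<close>

definition primes_upto :: "real \<Rightarrow> nat set" where
  "primes_upto y = {p. prime p \<and> real p \<le> y}"

lemma finite_primes_upto [simp, intro]: "finite (primes_upto y)"
proof (rule finite_subset)
  show "primes_upto y \<subseteq> {..nat \<lfloor>y\<rfloor>}"
    by (auto simp: primes_upto_def le_nat_floor)
qed simp

lemma prime_if_in_primes_upto: "p \<in> primes_upto y \<Longrightarrow> prime p"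
  by (simp add: primes_upto_def)

lemma prod_primes_dvd_iff:
  fixes n :: nat
  assumes "finite S" "\<And>p. p \<in> S \<Longrightarrow> prime p"
  shows "\<Prod>S dvd n \<longleftrightarrow> (\<forall>p\<in>S. p dvd n)"
  using assms
proof (induction S rule: finite_induct)
  case (insert q S)
  have "coprime q (\<Prod>S)"
    by (intro prod_coprime_right) (metis insert.hyps(2) insert.prems insertCI primes_coprime)
  then have "q * \<Prod>S dvd n \<longleftrightarrow> q dvd n \<and> \<Prod>S dvd n"
    by (meson divides_mult dvd_mult_left dvd_mult_right)
  with insert show ?case
    by simp
qed simp

text \<open>A prime of \<open>P\<close> contributes 1 + (X - 1) [p | n], which is X or 1.
  Multiplying out indexes the terms by subsets \<open>S\<close> of \<open>P\<close>, which encode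
  the squarefree numbers \<open>\<Prod>S\<close>.\<close>

lemma monom_card_prime_divisors:
  fixes n :: nat
  assumes "finite P" "\<And>p. p \<in> P \<Longrightarrow> prime p"
  shows "(monom 1 (card {p\<in>P. p dvd n}) :: real poly) =
    (\<Sum>S\<in>Pow P. smult (of_bool (\<Prod>S dvd n)) ([:-1, 1:] ^ card S))"
proof -
  have "(monom 1 (card {p\<in>P. p dvd n}) :: real poly) = [:0, 1:] ^ card {p\<in>P. p dvd n}"
    by (simp add: monom_altdef)
  also have "\<dots> = (\<Prod>p\<in>P. smult (of_bool (p dvd n)) [:-1, 1:] + 1)"
    using assms(1)
    by (subst prod.mono_neutral_cong_right[of P "{p\<in>P. p dvd n}" _ "\<lambda>_. [:0, 1:]"]) (auto simp: one_pCons)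
  also have "\<dots> = (\<Sum>S\<in>Pow P. \<Prod>p\<in>S. smult (of_bool (p dvd n)) [:-1, 1:])"
    using assms(1) by (simp add: prod_add)
  also have "\<dots> = (\<Sum>S\<in>Pow P. smult (of_bool (\<Prod>S dvd n)) ([:-1, 1:] ^ card S))"
  proof (intro sum.cong refl)
    fix S assume "S \<in> Pow P"
    then have S: "finite S" "\<And>p. p \<in> S \<Longrightarrow> prime p"
      using assms finite_subset by auto
    have "(\<Prod>p\<in>S. smult (of_bool (p dvd n)) [:-1, 1:] :: real poly) =
        smult (\<Prod>p\<in>S. of_bool (p dvd n)) ([:-1, 1:] ^ card S)"
      by (simp add: prod_smult del: smult_pCons)
    also have "(\<Prod>p\<in>S. of_bool (p dvd n)) = (of_bool (\<forall>p\<in>S. p dvd n) :: real)"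
      using S(1) by (induction S rule: finite_induct) auto
    finally show "(\<Prod>p\<in>S. smult (of_bool (p dvd n)) [:-1, 1:] :: real poly) =
        smult (of_bool (\<Prod>S dvd n)) ([:-1, 1:] ^ card S)"
      by (simp add: prod_primes_dvd_iff[OF S])
  qed
  finally show ?thesis .
qed

lemma card_multiples_upto:
  fixes d :: nat
  assumes "d > 0"
  shows "card {n\<in>{1..N}. d dvd n} = N div d"
proof -
  have "{n\<in>{1..N}. d dvd n} = (\<lambda>m. d * m) ` {1..N div d}"
    using assms by (auto simp: less_eq_div_iff_mult_less_eq mult.commute elim!: dvdE)
  also have "card \<dots> = N div d"
    using assms by (subst card_image) (auto simp: inj_on_def)
  finally show ?thesis .
qed

text \<open>Compare coefficients of X^k in the expansion of X^nu(n,y), sum over n, and count the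
  multiples of each squarefree number.\<close>

lemma N_count_eq_sum_subsets:
  "real (N_count k x y) = (\<Sum>S\<in>Pow (primes_upto y).
     coeff ([:-1, 1:] ^ card S) k * real (nat \<lfloor>x\<rfloor> div \<Prod>S))"
proof -
  define P where "P = primes_upto y"
  define N where "N = nat \<lfloor>x\<rfloor>"
  have P: "finite P" "\<And>p. p \<in> P \<Longrightarrow> prime p"
    by (auto simp: P_def prime_if_in_primes_upto)
  have nu: "nu n y = card {p\<in>P. p dvd n}" for n
    by (auto simp: nu_def P_def primes_upto_def intro!: arg_cong[of _ _ card])
  have *: "real n \<le> x \<longleftrightarrow> n \<le> N" if "1 \<le> n" for n
    using that unfolding N_def by linarith
  have "{n. 1 \<le> n \<and> real n \<le> x \<and> nu n y = k} = {n\<in>{1..N}. nu n y = k}"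
    using * by auto
  then have "real (N_count k x y) = (\<Sum>n\<in>{1..N}. of_bool (nu n y = k))"
    unfolding N_count_def by (simp add: Int_def)
  also have "\<dots> = (\<Sum>n\<in>{1..N}. coeff (monom 1 (card {p\<in>P. p dvd n})) k)"
    by (intro sum.cong) (auto simp: nu)
  also have "\<dots> = (\<Sum>n\<in>{1..N}. \<Sum>S\<in>Pow P. of_bool (\<Prod>S dvd n) * coeff ([:-1, 1:] ^ card S) k)"
    by (simp add: monom_card_prime_divisors[OF P] coeff_sum)
  also have "\<dots> = (\<Sum>S\<in>Pow P. \<Sum>n\<in>{1..N}. of_bool (\<Prod>S dvd n) * coeff ([:-1, 1:] ^ card S) k)"
    by (rule sum.swap)
  also have "\<dots> = (\<Sum>S\<in>Pow P. coeff ([:-1, 1:] ^ card S) k * real (N div \<Prod>S))"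
  proof (intro sum.cong refl)
    fix S assume "S \<in> Pow P"
    then have "\<Prod>S > 0"
      using P by (intro prod_pos) (auto simp: prime_gt_0_nat)
    then have "(\<Sum>n\<in>{1..N}. of_bool (\<Prod>S dvd n)) = real (N div \<Prod>S)"
      using card_multiples_upto[of "\<Prod>S" N] by (simp add: Int_def)
    then show "(\<Sum>n\<in>{1..N}. of_bool (\<Prod>S dvd n) * coeff ([:-1, 1:] ^ card S) k) =
        coeff ([:-1, 1:] ^ card S) k * real (N div \<Prod>S)"
      by (simp flip: sum_distrib_right)
  qed
  finally show ?thesis
    by (simp add: P_def N_def)
qed

text \<open>This is the value of the sieve sum when the number of multiples of d is replaced by x/d:
  it factors because 1 + (X - 1)/p = (1 - 1/p) (1 + X/(p - 1)).\<close>

lemma prod_sieve_weights: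
  assumes "finite P" "\<And>p. p \<in> P \<Longrightarrow> prime p"
  shows "(\<Sum>S\<in>Pow P. smult (1 / real (\<Prod>S)) ([:-1, 1:] ^ card S)) =
    smult (\<Prod>p\<in>P. 1 - 1 / real p) (\<Prod>p\<in>P. [:1, 1 / (real p - 1):])"
proof -
  have "(\<Prod>p\<in>P. smult (1 / real p) [:-1, 1:] + 1) =
      (\<Sum>S\<in>Pow P. \<Prod>p\<in>S. smult (1 / real p) [:-1, 1:])"
    using assms(1) by (simp add: prod_add)
  also have "\<dots> = (\<Sum>S\<in>Pow P. smult (1 / real (\<Prod>S)) ([:-1, 1:] ^ card S))"
  proof (intro sum.cong refl)
    fix S assume "S \<in> Pow P"
    have "(\<Prod>p\<in>S. 1 / real p) = 1 / real (\<Prod>S)"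
      by (simp add: prod_dividef)
    then show "(\<Prod>p\<in>S. smult (1 / real p) [:-1, 1:] :: real poly) =
        smult (1 / real (\<Prod>S)) ([:-1, 1:] ^ card S)"
      by (simp add: prod_smult del: smult_pCons)
  qed
  also have "(\<Prod>p\<in>P. smult (1 / real p) [:-1, 1:] + 1) =
      (\<Prod>p\<in>P. smult (1 - 1 / real p) [:1, 1 / (real p - 1):])"
  proof (intro prod.cong refl)
    fix p assume "p \<in> P"
    then have "real p > 1"
      using assms(2) prime_gt_1_nat by fastforce
    then show "smult (1 / real p) [:-1, 1:] + 1 = smult (1 - 1 / real p) [:1, 1 / (real p - 1):]"
      by (simp add: field_simps one_pCons)
  qed
  also have "\<dots> = smult (\<Prod>p\<in>P. 1 - 1 / real p) (\<Prod>p\<in>P. [:1, 1 / (real p - 1):])"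
    by (rule prod_smult)
  finally show ?thesis
    by simp
qed

text \<open>Up to sign these are the coefficients of (1 + X)^m, and a single nonnegative term of (1
  + r)^m is at most the whole sum. The induction is Pascal's rule.\<close>

lemma abs_coeff_linear_power_le:
  assumes "r \<ge> 0"
  shows "\<bar>coeff ([:-1, 1:] ^ m) k\<bar> * r ^ k \<le> (1 + r :: real) ^ m"
proof (induction m arbitrary: k)
  case 0
  show ?case
    using assms by (cases k) auto
next
  case (Suc m)
  let ?c = "\<lambda>k. \<bar>coeff ([:-1, 1 :: real:] ^ m) k\<bar>"
  show ?case
  proof (cases k)
    case 0
    then show ?thesis
      using Suc.IH[of 0] assms by (simp add: coeff_pCons distrib_right add_increasing2)
  next
    case (Suc j)
    have "\<bar>coeff ([:-1, 1:] ^ Suc m) k\<bar> * r ^ k \<le> (?c k + ?c j) * r ^ k"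
      using assms Suc by (intro mult_right_mono) auto
    also have "\<dots> = ?c k * r ^ k + r * (?c j * r ^ j)"
      by (simp add: Suc algebra_simps)
    also have "\<dots> \<le> (1 + r) ^ m + r * (1 + r) ^ m"
      using assms Suc.IH by (intro add_mono mult_left_mono) auto
    finally show ?thesis
      by (simp add: algebra_simps)
  qed
qed

text \<open>Rankin's trick: with t = x/d the rounding error is at most 1 if t \<ge> 1 and equals t
  if t < 1, and min(1, t) is at most every power of t with exponent in [0, 1].\<close>

lemma abs_floor_quotient_error_le:
  assumes "x \<ge> 1" "d > 0" "0 \<le> \<delta>" "\<delta> \<le> 1"
  shows "\<bar>real (nat \<lfloor>x\<rfloor> div d) - x / real d\<bar> \<le> (x / real d) powr (1 - \<delta>)"
proof -
  define t where "t = x / real d"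
  have t: "t > 0"
    using assms by (simp add: t_def)
  have "\<lfloor>t\<rfloor> = \<lfloor>x\<rfloor> div int d"
    using floor_divide_real_eq_div[of "int d" x] by (simp add: t_def)
  have eq: "real (nat \<lfloor>x\<rfloor> div d) = real_of_int \<lfloor>t\<rfloor>"
  proof -
    have "int (nat \<lfloor>x\<rfloor> div d) = \<lfloor>t\<rfloor>"
      using assms(1) \<open>\<lfloor>t\<rfloor> = \<lfloor>x\<rfloor> div int d\<close> by (simp add: zdiv_int)
    then show ?thesis
      by (metis of_int_of_nat_eq)
  qed
  have "\<bar>real_of_int \<lfloor>t\<rfloor> - t\<bar> \<le> t powr (1 - \<delta>)"
  proof (cases "t \<ge> 1")
    case True
    then have "1 \<le> t powr (1 - \<delta>)"
      using assms by (simp add: ge_one_powr_ge_zero)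
    then show ?thesis
      by linarith
  next
    case False
    then have "t powr 1 \<le> t powr (1 - \<delta>)"
      using t assms by (intro powr_mono') auto
    moreover have "\<lfloor>t\<rfloor> = 0"
      using t False by linarith
    ultimately show ?thesis
      using t by simp
  qed
  then show ?thesis
    by (simp add: eq t_def)
qed

text \<open>The factor \<open>r ^ k\<close> is kept on the left instead of being divided out, so
  that k = 0 with r = 0 is covered through 0^0 = 1.\<close>

theorem N_count_sieve_error:
  fixes x y r \<delta> :: real
  assumes "x \<ge> 1" "r \<ge> 0" "0 \<le> \<delta>" "\<delta> \<le> 1"
  defines "P \<equiv> primes_upto y"
  shows "\<bar>real (N_count k x y) - x * (\<Prod>p\<in>P. 1 - 1 / real p) *
      coeff (\<Prod>p\<in>P. [:1, 1 / (real p - 1):]) k\<bar> * r ^ k \<le>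
    x powr (1 - \<delta>) * (\<Prod>p\<in>P. 1 + (1 + r) * real p powr (\<delta> - 1))"
proof -
  have P: "finite P" "\<And>p. p \<in> P \<Longrightarrow> prime p"
    by (auto simp: P_def prime_if_in_primes_upto)
  let ?c = "\<lambda>S::nat set. coeff ([:-1, 1 :: real:] ^ card S) k"
  have "x * (\<Prod>p\<in>P. 1 - 1 / real p) * coeff (\<Prod>p\<in>P. [:1, 1 / (real p - 1):]) k =
      (\<Sum>S\<in>Pow P. ?c S * (x / real (\<Prod>S)))"
    using arg_cong[OF prod_sieve_weights[OF P], of "\<lambda>p. x * coeff p k"]
    by (simp add: coeff_sum sum_distrib_left field_simps)
  then have "\<bar>real (N_count k x y) - x * (\<Prod>p\<in>P. 1 - 1 / real p) *
      coeff (\<Prod>p\<in>P. [:1, 1 / (real p - 1):]) k\<bar> * r ^ k =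
      \<bar>\<Sum>S\<in>Pow P. ?c S * (real (nat \<lfloor>x\<rfloor> div \<Prod>S) - x / real (\<Prod>S))\<bar> * r ^ k"
    by (simp add: N_count_eq_sum_subsets P_def sum_subtractf right_diff_distrib)
  also have "\<dots> \<le> (\<Sum>S\<in>Pow P. \<bar>?c S * (real (nat \<lfloor>x\<rfloor> div \<Prod>S) - x / real (\<Prod>S))\<bar>) * r ^ k"
    using assms(2) by (intro mult_right_mono sum_abs) auto
  also have "\<dots> = (\<Sum>S\<in>Pow P. \<bar>?c S\<bar> * r ^ k * \<bar>real (nat \<lfloor>x\<rfloor> div \<Prod>S) - x / real (\<Prod>S)\<bar>)"
    by (simp add: sum_distrib_left sum_distrib_right abs_mult mult_ac)
  also have "\<dots> \<le> (\<Sum>S\<in>Pow P. (1 + r) ^ card S * (x / real (\<Prod>S)) powr (1 - \<delta>))"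
  proof (intro sum_mono mult_mono abs_coeff_linear_power_le abs_floor_quotient_error_le)
    fix S assume "S \<in> Pow P"
    then show "\<Prod>S > 0"
      using P by (intro prod_pos) (auto simp: prime_gt_0_nat)
  qed (use assms in auto)
  also have "\<dots> = (\<Sum>S\<in>Pow P. x powr (1 - \<delta>) * (\<Prod>p\<in>S. (1 + r) * real p powr (\<delta> - 1)))"
  proof (intro sum.cong refl)
    fix S assume "S \<in> Pow P"
    then have S: "finite S" "\<And>p. p \<in> S \<Longrightarrow> prime p"
      using P finite_subset by auto
    have "(\<Prod>p\<in>S. (1 + r) * real p powr (\<delta> - 1)) = (1 + r) ^ card S * (\<Prod>p\<in>S. real p powr (\<delta> - 1))"
      by (simp add: prod.distrib)
    also have "(\<Prod>p\<in>S. real p powr (\<delta> - 1)) = real (\<Prod>S) powr (\<delta> - 1)"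
      by (simp add: prod_powr_distrib)
    finally have eq: "(\<Prod>p\<in>S. (1 + r) * real p powr (\<delta> - 1)) =
        (1 + r) ^ card S * real (\<Prod>S) powr (\<delta> - 1)" .
    have "(x / real (\<Prod>S)) powr (1 - \<delta>) = x powr (1 - \<delta>) * real (\<Prod>S) powr (\<delta> - 1)"
      using assms(1) powr_minus_divide[of "real (\<Prod>S)" "1 - \<delta>"]
      by (simp add: powr_divide)
    then show "(1 + r) ^ card S * (x / real (\<Prod>S)) powr (1 - \<delta>) =
        x powr (1 - \<delta>) * (\<Prod>p\<in>S. (1 + r) * real p powr (\<delta> - 1))"
      by (simp add: eq)
  qed
  also have "\<dots> = x powr (1 - \<delta>) * (\<Prod>p\<in>P. (1 + r) * real p powr (\<delta> - 1) + 1)"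
    using P(1) by (simp add: prod_add sum_distrib_left)
  finally show ?thesis
    by (simp add: add.commute)
qed

section \<open>Coefficients of products of linear factors\<close>

text \<open>A weighted l1 norm of power series, stated as a bound together with summability because
  \<open>suminf\<close> says nothing about a divergent series. It controls all coefficients and all
  values on [-R, R] at once.\<close>

definition l1_bound :: "real \<Rightarrow> real fps \<Rightarrow> real \<Rightarrow> bool" where
  "l1_bound R f B \<longleftrightarrow> summable (\<lambda>n. \<bar>fps_nth f n\<bar> * R ^ n) \<and> (\<Sum>n. \<bar>fps_nth f n\<bar> * R ^ n) \<le> B"

lemma l1_boundI:
  assumes "\<And>n. \<bar>fps_nth f n\<bar> * R ^ n \<le> u n" "u sums B" "R \<ge> 0"
  shows "l1_bound R f B"
proof -
  have "summable (\<lambda>n. \<bar>fps_nth f n\<bar> * R ^ n)"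
    by (rule summable_comparison_test'[of u 0]) (use assms in \<open>auto simp: sums_iff\<close>)
  then show ?thesis
    using assms suminf_le[of "\<lambda>n. \<bar>fps_nth f n\<bar> * R ^ n" u] by (simp add: l1_bound_def sums_iff)
qed

lemma l1_bound_nonneg: "l1_bound R f B \<Longrightarrow> R \<ge> 0 \<Longrightarrow> B \<ge> 0"
  unfolding l1_bound_def
  by (meson abs_ge_zero mult_nonneg_nonneg order_trans suminf_nonneg zero_le_power)

lemma l1_bound_mono: "l1_bound R f B \<Longrightarrow> B \<le> C \<Longrightarrow> l1_bound R f C"
  by (simp add: l1_bound_def)

text \<open>Submultiplicativity, by the Cauchy product. It reduces a product over primes to one
  factor per prime.\<close>

lemma l1_bound_mult:
  assumes "l1_bound R f B" "l1_bound R g C" "R \<ge> 0"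
  shows "l1_bound R (f * g) (B * C)"
proof -
  let ?f = "\<lambda>n. \<bar>fps_nth f n\<bar> * R ^ n" and ?g = "\<lambda>n. \<bar>fps_nth g n\<bar> * R ^ n"
  have s: "summable ?f" "summable ?g"
    using assms by (auto simp: l1_bound_def)
  have "(\<lambda>n. \<Sum>i\<le>n. ?f i * ?g (n - i)) sums (suminf ?f * suminf ?g)"
    using s assms(3) by (intro Cauchy_product_sums) (auto simp: abs_mult)
  moreover have "\<bar>fps_nth (f * g) n\<bar> * R ^ n \<le> (\<Sum>i\<le>n. ?f i * ?g (n - i))" for n
  proof -
    have "\<bar>fps_nth (f * g) n\<bar> * R ^ n \<le> (\<Sum>i\<le>n. \<bar>fps_nth f i * fps_nth g (n - i)\<bar>) * R ^ n"
      using assms(3) unfolding fps_mult_nth atMost_atLeast0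
      by (intro mult_right_mono sum_abs) auto
    also have "\<dots> = (\<Sum>i\<le>n. ?f i * ?g (n - i))"
      unfolding sum_distrib_right
    proof (intro sum.cong refl)
      fix i assume "i \<in> {..n}"
      then have "R ^ n = R ^ i * R ^ (n - i)"
        by (simp flip: power_add)
      then show "\<bar>fps_nth f i * fps_nth g (n - i)\<bar> * R ^ n = ?f i * ?g (n - i)"
        by (simp add: abs_mult)
    qed
    finally show ?thesis .
  qed
  ultimately have "l1_bound R (f * g) (suminf ?f * suminf ?g)"
    using assms(3) by (intro l1_boundI)
  moreover have "suminf ?f * suminf ?g \<le> B * C"
    using assms l1_bound_nonneg[OF assms(1,3)] s
    by (intro mult_mono suminf_nonneg) (auto simp: l1_bound_def)
  ultimately show ?thesis
    by (rule l1_bound_mono)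
qed

lemma l1_bound_one: "l1_bound R 1 1"
proof -
  have "(\<lambda>n. \<bar>fps_nth 1 n\<bar> * R ^ n) = (\<lambda>n. if n = 0 then 1 else 0)"
    by auto
  then show ?thesis
    using sums_single[of 0 "\<lambda>_. 1::real"] by (simp add: l1_bound_def sums_iff)
qed

lemma l1_bound_prod:
  assumes "\<And>i. i \<in> I \<Longrightarrow> l1_bound R (f i) (B i)" "R \<ge> 0"
  shows "l1_bound R (\<Prod>i\<in>I. f i) (\<Prod>i\<in>I. B i)"
  using assms by (induction I rule: infinite_finite_induct) (auto intro: l1_bound_mult l1_bound_one)

lemma l1_bound_exp:
  assumes "R \<ge> 0"
  shows "l1_bound R (fps_exp c) (exp (\<bar>c\<bar> * R))"
proof (rule l1_boundI)
  show "(\<lambda>n. (\<bar>c\<bar> * R) ^ n / fact n) sums exp (\<bar>c\<bar> * R)"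
    using exp_converges[of "\<bar>c\<bar> * R"] by (simp add: field_simps)
qed (use assms in \<open>auto simp: power_abs power_mult_distrib\<close>)

text \<open>The linear coefficient \<open>a - b\<close> is quadratically small, which makes the norm of
  the factor summable over the primes when \<open>a = 1 / (p - 1)\<close>.\<close>

lemma l1_bound_linear_times_exp:
  assumes "0 \<le> b" "b \<le> a" "a \<le> 1" "a - b \<le> a\<^sup>2" "R \<ge> 0"
  shows "l1_bound R (fps_of_poly [:1, a:] * fps_exp (- b)) (1 + a\<^sup>2 * exp (2 * R))"
proof (rule l1_boundI)
  let ?f = "fps_of_poly [:1, a:] * fps_exp (- b)"
  have f: "?f = fps_exp (- b) + fps_const a * (fps_X * fps_exp (- b))"
    by (simp add: fps_of_poly_pCons algebra_simps)
  have "(\<lambda>n. if n = 0 then 1 else 0 :: real) sums 1"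
    using sums_single[of 0 "\<lambda>_. 1::real"] by simp
  moreover have "(\<lambda>n. a\<^sup>2 * ((2 * R) ^ n / fact n)) sums (a\<^sup>2 * exp (2 * R))"
    using exp_converges[of "2 * R"] by (intro sums_mult) (simp add: field_simps)
  ultimately show "(\<lambda>n. (if n = 0 then 1 else 0) + a\<^sup>2 * ((2 * R) ^ n / fact n)) sums
      (1 + a\<^sup>2 * exp (2 * R))"
    by (rule sums_add)
  fix n
  have a: "a \<ge> 0"
    using assms by linarith
  show "\<bar>fps_nth ?f n\<bar> * R ^ n \<le> (if n = 0 then 1 else 0) + a\<^sup>2 * ((2 * R) ^ n / fact n)"
  proof (cases n)
    case 0
    then show ?thesis
      by (simp add: f)
  next
    case (Suc m)
    have nth: "fps_nth ?f n = (- b) ^ m / fact n * (real n * a - b)"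
    proof -
      have "fps_nth ?f n = (- b) ^ Suc m / fact (Suc m) + a * ((- b) ^ m / fact m)"
        unfolding f Suc by (simp del: fact_Suc)
      also have "(- b) ^ m / fact m = (- b) ^ m * (real (Suc m) / fact (Suc m))"
        by simp
      finally show ?thesis
        by (simp add: Suc field_simps del: fact_Suc of_nat_Suc)
    qed
    \<comment> \<open>Two factors \<open>a\<close> must be found. For n = 1 they come from the
      hypothesis on a - b; for n \<ge> 2 one comes from \<open>b ^ m\<close> and the other from n a
      - b.\<close>
    have "\<bar>(- b) ^ m * (real n * a - b)\<bar> \<le> a\<^sup>2 * real (Suc n)"
    proof (cases m)
      case 0
      then show ?thesis
        using assms a Suc by (simp add: abs_if algebra_simps)
    next
      case (Suc l)
      have "b ^ m \<le> a ^ 1"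
        using assms a Suc by (intro order.trans[OF power_mono[of b a m] power_decreasing]) auto
      moreover have "0 \<le> real n * a"
        using a by simp
      then have "\<bar>real n * a - b\<bar> \<le> real n * a + a"
        using assms(1,2) a by linarith
      then have "\<bar>real n * a - b\<bar> \<le> a * real (Suc n)"
        by (simp add: algebra_simps)
      ultimately have "b ^ m * \<bar>real n * a - b\<bar> \<le> a * (a * real (Suc n))"
        using a assms by (intro mult_mono) auto
      then show ?thesis
        using assms by (simp add: abs_mult power_abs power2_eq_square mult_ac)
    qed
    \<comment> \<open>The factor n + 1 is paid for by doubling R, whence
      \<open>exp (2 * R)\<close>.\<close>
    also have "\<dots> \<le> a\<^sup>2 * real (2 ^ n)"
      by (intro mult_left_mono of_nat_mono Suc_leI less_exp) auto
    finally have "\<bar>(- b) ^ m * (real n * a - b)\<bar> * (R ^ n / fact n) \<le> a\<^sup>2 * real (2 ^ n) * (R ^ n / fact n)"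
      using assms by (intro mult_right_mono) auto
    then show ?thesis
      unfolding nth using Suc by (simp add: abs_mult power_mult_distrib mult_ac)
  qed
qed (use assms in auto)

text \<open>With D_j the normalized falling factorial and r = k/L, r^(j+1) - D_(j+1) = r (r^j - D_j)
  + D_j j/L. Induction sums the last terms, and 0 + 1 + ... + (j-1) is at most j^2/2.\<close>

lemma abs_power_minus_falling_le:
  fixes L A :: real
  assumes "L > 0" "A \<ge> 1" "real k / L \<le> A"
  shows "\<bar>(real k / L) ^ j - (\<Prod>i<j. (real k - real i) / L)\<bar> \<le> real j ^ 2 / 2 * A ^ j * (real k / L\<^sup>2)"
proof (induction j)
  case (Suc j)
  define r where "r = real k / L"
  define D where "D = (\<Prod>i<j. (real k - real i) / L)"
  have r: "0 \<le> r" "r \<le> A"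
    using assms by (auto simp: r_def)
  have D: "\<bar>D\<bar> \<le> r ^ j"
  proof (cases "j \<le> k")
    case True
    have "D \<le> (\<Prod>i<j. r)"
      unfolding D_def r_def using True assms by (intro prod_mono) (auto intro!: divide_right_mono)
    moreover have "D \<ge> 0"
      unfolding D_def using True assms by (intro prod_nonneg) auto
    ultimately show ?thesis
      by simp
  next
    case False
    then have "D = 0"
      using assms unfolding D_def by (intro prod_zero) (auto intro!: bexI[of _ k])
    with r show ?thesis
      by simp
  qed
  have "\<bar>D * (real j / L)\<bar> \<le> r ^ j * (real j / L)"
    unfolding abs_mult using D assms by (intro mult_mono) auto
  \<comment> \<open>For j = 0 the left side is 0. Otherwise one factor r = k/L is split off the
    power, and with 1/L it gives k/L^2.\<close>
  also have "\<dots> \<le> A ^ Suc j * (real j * (real k / L\<^sup>2))"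
  proof (cases j)
    case (Suc i)
    have "r ^ j * (real j / L) = r ^ i * (real j * (real k / L\<^sup>2))"
      by (simp add: r_def Suc power2_eq_square)
    also have "\<dots> \<le> A ^ Suc j * (real j * (real k / L\<^sup>2))"
    proof (intro mult_right_mono)
      have "r ^ i \<le> A ^ i"
        using r by (intro power_mono) auto
      also have "A ^ i \<le> A ^ Suc j"
        using assms Suc by (intro power_increasing) auto
      finally show "r ^ i \<le> A ^ Suc j" .
    qed auto
    finally show ?thesis .
  qed simp
  finally have 1: "\<bar>D * (real j / L)\<bar> \<le> A ^ Suc j * (real j * (real k / L\<^sup>2))" .
  have "\<bar>r * (r ^ j - D)\<bar> \<le> A * (real j ^ 2 / 2 * A ^ j * (real k / L\<^sup>2))"
    unfolding abs_mult using r Suc.IH by (intro mult_mono) (auto simp: r_def D_def)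
  with 1 have "\<bar>r * (r ^ j - D) + D * (real j / L)\<bar> \<le>
      A * (real j ^ 2 / 2 * A ^ j * (real k / L\<^sup>2)) + A ^ Suc j * (real j * (real k / L\<^sup>2))"
    by linarith
  also have "\<dots> = (real j ^ 2 / 2 + real j) * A ^ Suc j * (real k / L\<^sup>2)"
    by (simp add: algebra_simps)
  also have "\<dots> \<le> (real (Suc j) ^ 2 / 2) * A ^ Suc j * (real k / L\<^sup>2)"
    using assms by (intro mult_right_mono) (auto simp: power2_eq_square algebra_simps)
  also have "r * (r ^ j - D) + D * (real j / L) = r ^ Suc j - D * ((real k - real j) / L)"
    by (simp add: r_def diff_divide_distrib algebra_simps)
  finally show ?case
    by (simp add: r_def D_def)
qed simp

text \<open>The loss j^2/2 from the falling factorials is thereby absorbed by taking the norm at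
  radius \<open>2 * A\<close> instead of \<open>A\<close>.\<close>

lemma real_square_le_power_two: "real j ^ 2 / 2 \<le> 2 ^ j"
proof -
  have "j ^ 2 \<le> 2 * 2 ^ j"
  proof (induction j)
    case (Suc j)
    show ?case
    proof (cases "j \<ge> 3")
      case True
      then have "3 * j \<le> j * j"
        by simp
      then have "1 + 2 * j \<le> j * j"
        using True by linarith
      then have "(Suc j) ^ 2 \<le> 2 * j ^ 2"
        by (simp add: power2_eq_square)
      with Suc show ?thesis
        by simp
    next
      case False
      then have "j = 0 \<or> j = 1 \<or> j = 2"
        by linarith
      then show ?thesis
        by (auto simp: power2_eq_square)
    qed
  qed simp
  then have "real (j ^ 2) \<le> real (2 * 2 ^ j)"
    using of_nat_le_iff by blast
  then show ?thesis
    by simp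
qed

text \<open>The choice \<open>r = k / L\<close> makes the first-order term vanish: \<open>k\<^sup>j\<close> and the falling
  factorial of \<open>k\<close> agree up to \<open>O(j\<^sup>2 k\<^bsup>j-1\<^esup>)\<close>, and exactly for \<open>j \<le> 1\<close>.\<close>

lemma fps_nth_mult_exp_approx:
  fixes g :: "real fps" and L A B :: real
  assumes g: "l1_bound (2 * A) g B" and "L > 0" "A \<ge> 1" "real k / L \<le> A"
  shows "\<bar>fps_nth (g * fps_exp L) k - L ^ k / fact k * (\<Sum>n. fps_nth g n * (real k / L) ^ n)\<bar>
    \<le> L ^ k / fact k * (B * (real k / L\<^sup>2))"
proof -
  define r where "r = real k / L"
  define D where "D = (\<lambda>j. \<Prod>i<j. (real k - real i) / L)"
  have r: "0 \<le> r" "r \<le> A"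
    using assms by (auto simp: r_def)
  have sg: "summable (\<lambda>n. \<bar>fps_nth g n\<bar> * (2 * A) ^ n)" "(\<Sum>n. \<bar>fps_nth g n\<bar> * (2 * A) ^ n) \<le> B"
    using g by (auto simp: l1_bound_def)
  have "\<bar>fps_nth g n * r ^ n\<bar> \<le> \<bar>fps_nth g n\<bar> * (2 * A) ^ n" for n
    unfolding abs_mult power_abs using r by (intro mult_left_mono power_mono) auto
  then have sr: "summable (\<lambda>n. fps_nth g n * r ^ n)"
    by (intro summable_comparison_test'[OF sg(1), of 0]) simp
  \<comment> \<open>Falling factorials vanish beyond k, so the finite Cauchy product for the k-th
    coefficient is a full series over j and can be compared termwise with the series at r.\<close>
  have D0: "D j = 0" if "j > k" for j
    using that assms unfolding D_def by (intro prod_zero) (auto intro!: bexI[of _ k])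
  have Deq: "L ^ k / fact k * D j = L ^ (k - j) / fact (k - j)" if "j \<le> k" for j
    using that
  proof (induction j)
    case (Suc j)
    have kj: "k - j = Suc (k - Suc j)"
      using Suc.prems by simp
    have "L ^ k / fact k * D (Suc j) = L ^ (k - j) / fact (k - j) * ((real k - real j) / L)"
      unfolding Suc.IH[OF Suc_leD[OF Suc.prems], symmetric] by (simp add: D_def)
    also have "real k - real j = real (k - j)"
      using Suc.prems by simp
    also have "L ^ (k - j) / fact (k - j) * (real (k - j) / L) = L ^ (k - Suc j) / fact (k - Suc j)"
      using assms(2) unfolding kj by simp
    finally show ?case .
  qed (simp add: D_def)
  have Dsums: "(\<lambda>n. fps_nth g n * D n) sums (\<Sum>j\<le>k. fps_nth g j * D j)"
    by (rule sums_finite) (auto simp: D0)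
  have nth: "fps_nth (g * fps_exp L) k = L ^ k / fact k * (\<Sum>j\<le>k. fps_nth g j * D j)"
    unfolding fps_mult_nth atLeast0AtMost sum_distrib_left
  proof (intro sum.cong refl)
    fix j assume "j \<in> {..k}"
    then have "L ^ k / fact k * (fps_nth g j * D j) = fps_nth g j * (L ^ (k - j) / fact (k - j))"
      using Deq[of j] by (metis atMost_iff mult.left_commute)
    then show "fps_nth g j * fps_nth (fps_exp L) (k - j) = L ^ k / fact k * (fps_nth g j * D j)"
      by simp
  qed
  have le: "\<bar>fps_nth g n * r ^ n - fps_nth g n * D n\<bar> \<le> \<bar>fps_nth g n\<bar> * (2 * A) ^ n * (real k / L\<^sup>2)" for n
  proof -
    have "\<bar>r ^ n - D n\<bar> \<le> real n ^ 2 / 2 * A ^ n * (real k / L\<^sup>2)"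
      unfolding r_def D_def by (rule abs_power_minus_falling_le) fact+
    also have "\<dots> \<le> 2 ^ n * A ^ n * (real k / L\<^sup>2)"
      using assms by (intro mult_right_mono real_square_le_power_two) auto
    finally have "\<bar>fps_nth g n\<bar> * \<bar>r ^ n - D n\<bar> \<le> \<bar>fps_nth g n\<bar> * (2 ^ n * A ^ n * (real k / L\<^sup>2))"
      by (intro mult_left_mono) auto
    then show ?thesis
      unfolding right_diff_distrib[symmetric] abs_mult power_mult_distrib by (simp add: mult_ac)
  qed
  have s3: "summable (\<lambda>n. \<bar>fps_nth g n\<bar> * (2 * A) ^ n * (real k / L\<^sup>2))"
    using sg(1) by (rule summable_mult2)
  have "(\<Sum>n. fps_nth g n * r ^ n) - (\<Sum>j\<le>k. fps_nth g j * D j) =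
      (\<Sum>n. fps_nth g n * r ^ n - fps_nth g n * D n)"
    using suminf_diff[OF sr, of "\<lambda>n. fps_nth g n * D n"] Dsums by (simp add: sums_iff)
  also have "\<bar>\<dots>\<bar> \<le> (\<Sum>n. \<bar>fps_nth g n\<bar> * (2 * A) ^ n * (real k / L\<^sup>2))"
    using norm_suminf_le[OF _ s3, of "\<lambda>n. fps_nth g n * r ^ n - fps_nth g n * D n"] le by simp
  also have "\<dots> = (\<Sum>n. \<bar>fps_nth g n\<bar> * (2 * A) ^ n) * (real k / L\<^sup>2)"
    by (rule suminf_mult2[OF sg(1), symmetric])
  also have "\<dots> \<le> B * (real k / L\<^sup>2)"
    using sg(2) assms by (intro mult_right_mono) auto
  finally have "L ^ k / fact k * \<bar>(\<Sum>n. fps_nth g n * r ^ n) - (\<Sum>j\<le>k. fps_nth g j * D j)\<bar> \<le>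
      L ^ k / fact k * (B * (real k / L\<^sup>2))"
    using assms by (intro mult_left_mono) auto
  moreover have "\<bar>fps_nth (g * fps_exp L) k - L ^ k / fact k * (\<Sum>n. fps_nth g n * r ^ n)\<bar> =
      L ^ k / fact k * \<bar>(\<Sum>n. fps_nth g n * r ^ n) - (\<Sum>j\<le>k. fps_nth g j * D j)\<bar>"
    unfolding nth right_diff_distrib[symmetric] using assms
    by (simp add: abs_mult abs_minus_commute)
  ultimately show ?thesis
    by (simp add: r_def)
qed

lemma diff_ln_add_one_le_square:
  fixes t :: real
  assumes "t \<ge> 0"
  shows "t - ln (1 + t) \<le> t\<^sup>2"
proof (cases "t \<le> 1")
  case True
  with assms show ?thesis
    using ln_one_plus_pos_lower_bound[of t] by simp
next
  case False
  then have "t * 1 \<le> t * t"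
    by (intro mult_left_mono) auto
  moreover have "ln (1 + t) \<ge> 0"
    using assms by simp
  ultimately show ?thesis
    unfolding power2_eq_square by linarith
qed

text \<open>The exponential e^(-LX) is distributed over the factors with exponents b_p = ln(1 +
  a_p). Each factor then has norm 1 + O(a_p^2), uniformly in the size of \<open>P\<close>, and what
  remains is exp((sum of b_p - L) X), whose norm is bounded because the exponent is. For a_p = 1/(p
  - 1) the sum of b_p is the sum in Mertens' third theorem.\<close>

lemma coeff_prod_linear_approx:
  fixes a :: "'i \<Rightarrow> real" and L A D Q :: real
  assumes P: "finite P" "\<And>p. p \<in> P \<Longrightarrow> 0 \<le> a p \<and> a p \<le> 1"
    and Q: "(\<Sum>p\<in>P. (a p)\<^sup>2) \<le> Q" and D: "\<bar>(\<Sum>p\<in>P. ln (1 + a p)) - L\<bar> \<le> D"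
    and "L > 0" "A \<ge> 1" "real k / L \<le> A"
  shows "\<bar>coeff (\<Prod>p\<in>P. [:1, a p:]) k -
      L ^ k / fact k * ((\<Prod>p\<in>P. 1 + a p * (real k / L)) * exp (- L * (real k / L)))\<bar>
    \<le> L ^ k / fact k * (exp (exp (4 * A) * Q + 2 * A * D) * (real k / L\<^sup>2))"
proof -
  define f where "f = (\<Prod>p\<in>P. [:1, a p:])"
  define b where "b = (\<lambda>p. ln (1 + a p))"
  define g where "g = fps_of_poly f * fps_exp (- L)"
  define r where "r = real k / L"
  have b_sum: "(\<Prod>p\<in>P. fps_exp (- b p)) = fps_exp (- (\<Sum>p\<in>P. b p))"
    using P(1) by (induction P rule: finite_induct) (auto simp: fps_exp_add_mult[symmetric] algebra_simps)
  have "g = (\<Prod>p\<in>P. fps_of_poly [:1, a p:] * fps_exp (- b p)) * fps_exp ((\<Sum>p\<in>P. b p) - L)"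
    unfolding prod.distrib b_sum
    by (simp add: g_def f_def fps_of_poly_prod mult.assoc fps_exp_add_mult[symmetric])
  also have "l1_bound (2 * A) \<dots> ((\<Prod>p\<in>P. 1 + (a p)\<^sup>2 * exp (2 * (2 * A))) *
      exp (\<bar>(\<Sum>p\<in>P. b p) - L\<bar> * (2 * A)))"
    using assms
    by (intro l1_bound_mult l1_bound_prod l1_bound_exp l1_bound_linear_times_exp)
      (auto simp: b_def ln_add_one_self_le_self diff_ln_add_one_le_square)
  finally have "l1_bound (2 * A) g ((\<Prod>p\<in>P. 1 + (a p)\<^sup>2 * exp (2 * (2 * A))) *
      exp (\<bar>(\<Sum>p\<in>P. b p) - L\<bar> * (2 * A)))" .
  moreover have "(\<Prod>p\<in>P. 1 + (a p)\<^sup>2 * exp (2 * (2 * A))) * exp (\<bar>(\<Sum>p\<in>P. b p) - L\<bar> * (2 * A))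
      \<le> exp (exp (4 * A) * Q + 2 * A * D)"
  proof -
    have "(\<Prod>p\<in>P. 1 + (a p)\<^sup>2 * exp (2 * (2 * A))) \<le> exp (\<Sum>p\<in>P. (a p)\<^sup>2 * exp (2 * (2 * A)))"
      by (rule prod_le_exp_sum) simp
    also have "\<dots> \<le> exp (exp (4 * A) * Q)"
      using Q by (simp add: mult.commute flip: sum_distrib_right)
    finally have "(\<Prod>p\<in>P. 1 + (a p)\<^sup>2 * exp (2 * (2 * A))) \<le> exp (exp (4 * A) * Q)" .
    moreover have "exp (\<bar>(\<Sum>p\<in>P. b p) - L\<bar> * (2 * A)) \<le> exp (2 * A * D)"
      using D \<open>A \<ge> 1\<close> by (simp add: b_def mult.commute)
    ultimately show ?thesis
      unfolding exp_add by (intro mult_mono) auto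
  qed
  ultimately have "l1_bound (2 * A) g (exp (exp (4 * A) * Q + 2 * A * D))"
    by (rule l1_bound_mono)
  from fps_nth_mult_exp_approx[OF this \<open>L > 0\<close> \<open>A \<ge> 1\<close> \<open>real k / L \<le> A\<close>]
  have "\<bar>fps_nth (g * fps_exp L) k - L ^ k / fact k * (\<Sum>n. fps_nth g n * r ^ n)\<bar>
      \<le> L ^ k / fact k * (exp (exp (4 * A) * Q + 2 * A * D) * (real k / L\<^sup>2))"
    by (simp add: r_def)
  moreover have "g * fps_exp L = fps_of_poly f"
    by (simp add: g_def mult.assoc fps_exp_add_mult[symmetric])
  moreover have "(\<Sum>n. fps_nth g n * r ^ n) = eval_fps g r"
    by (simp add: eval_fps_def)
  moreover have "eval_fps g r = poly f r * exp (- L * r)"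
    unfolding g_def by (subst eval_fps_mult) auto
  moreover have "poly f r = (\<Prod>p\<in>P. 1 + a p * r)"
    by (simp add: f_def poly_prod mult.commute)
  ultimately show ?thesis
    by (simp add: f_def r_def)
qed

section \<open>Mertens' theorems\<close>

lemma primes_upto_of_nat: "primes_upto (real n) = {p. prime p \<and> p \<le> n}"
  by (simp add: primes_upto_def)

lemma primes_upto_floor:
  assumes "y \<ge> 0"
  shows "primes_upto y = primes_upto (real (nat \<lfloor>y\<rfloor>))"
proof -
  have "real p \<le> y \<longleftrightarrow> real p \<le> real (nat \<lfloor>y\<rfloor>)" for p
    using assms unfolding of_nat_le_iff by linarith
  then show ?thesis
    by (simp add: primes_upto_def)
qed

lemma primes_upto_Suc:
  "primes_upto (real (Suc n)) = (if prime (Suc n) then {Suc n} else {}) \<union> primes_upto (real n)"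
  unfolding primes_upto_of_nat by (auto simp: le_Suc_eq)

text \<open>Erdos' argument: for n = 2m + 1 the primes in (m + 1, n] all divide n choose m. This
  binomial coefficient occurs twice in a row with sum 2 * 4^m, hence is at most 4^m, and the primes
  up to m + 1 are covered by induction.\<close>

lemma prod_primes_upto_le: "\<Prod>(primes_upto (real n)) \<le> 4 ^ n"
proof (induction n rule: less_induct)
  case (less n)
  consider "n \<le> 2" | "n > 2" "even n" | "n > 2" "odd n"
    by linarith
  then show ?case
  proof cases
    case 1
    have "primes_upto (real n) \<subseteq> {2}"
      unfolding primes_upto_of_nat using 1 by (auto dest: prime_ge_2_nat)
    then have "\<Prod>(primes_upto (real n)) \<le> \<Prod>{2} \<or> primes_upto (real n) = {}"
      by (metis order.refl subset_singletonD)
    moreover have "primes_upto (real n) = {}" if "n < 2"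
      unfolding primes_upto_of_nat using that by (auto dest: prime_ge_2_nat)
    ultimately show ?thesis
      using 1 by (cases "n = 2") (auto simp: le_eq_less_or_eq[of n])
  next
    case 2
    then obtain m where m: "n = Suc m"
      by (cases n) auto
    have "\<not> prime n"
      using 2 prime_odd_nat by blast
    then have "primes_upto (real n) = primes_upto (real m)"
      unfolding m primes_upto_Suc by simp
    moreover have "(4::nat) ^ m \<le> 4 ^ n"
      by (simp add: m)
    ultimately show ?thesis
      using less.IH[of m] m by simp
  next
    case 3
    then obtain m where n: "n = 2 * m + 1"
      by (auto elim: oddE)
    with 3 have m: "m \<ge> 1"
      by simp
    define Q where "Q = {p. prime p \<and> m + 1 < p \<and> p \<le> n}"
    have Q: "finite Q" "\<And>p. p \<in> Q \<Longrightarrow> prime p"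
      by (auto simp: Q_def)
    have "p dvd n choose m" if "p \<in> Q" for p
    proof -
      have p: "prime p" "m + 1 < p" "p \<le> n"
        using that by (auto simp: Q_def)
      have "fact m * fact (n - m) * (n choose m) = fact n"
        using n by (intro binomial_fact_lemma) simp
      moreover have "p dvd fact n"
        using p by (simp add: prime_dvd_fact_iff)
      ultimately have "p dvd fact m * fact (n - m) * (n choose m)"
        by simp
      moreover have "\<not> p dvd fact m" "\<not> p dvd fact (n - m)"
        using p n by (auto simp: prime_dvd_fact_iff simp del: fact_Suc)
      ultimately show ?thesis
        using p by (simp add: prime_dvd_mult_iff)
    qed
    then have "\<Prod>Q dvd n choose m"
      by (simp add: prod_primes_dvd_iff[OF Q])
    then have "\<Prod>Q \<le> n choose m"
      using n by (intro dvd_imp_le) (auto simp: zero_less_binomial_iff)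
    also have "n choose m \<le> 4 ^ m"
    proof -
      have "(n choose m) + (n choose (m + 1)) = (\<Sum>k\<in>{m, m + 1}. n choose k)"
        by simp
      also have "\<dots> \<le> (\<Sum>k\<le>n. n choose k)"
        using n by (intro sum_mono2) auto
      also have "\<dots> = 2 * 4 ^ m"
        unfolding choose_row_sum by (simp add: n power_mult)
      also have "n choose (m + 1) = n choose m"
        using binomial_symmetric[of m n] n by simp
      finally show ?thesis
        by simp
    qed
    finally have Q_le: "\<Prod>Q \<le> 4 ^ m" .
    have "primes_upto (real n) = primes_upto (real (m + 1)) \<union> Q"
      unfolding primes_upto_of_nat Q_def using n by auto
    also have "\<Prod>\<dots> = \<Prod>(primes_upto (real (m + 1))) * \<Prod>Q"
      using Q(1) by (intro prod.union_disjoint finite_primes_upto) (auto simp: primes_upto_def Q_def)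
    also have "\<dots> \<le> 4 ^ (m + 1) * 4 ^ m"
      using n m Q_le less.IH[of "m + 1"] by (intro mult_mono) auto
    also have "\<dots> = 4 ^ n"
      by (simp add: n mult_2 power_add)
    finally show ?thesis .
  qed
qed

lemma sum_ln_primes_upto_le: "(\<Sum>p\<in>primes_upto (real n). ln (real p)) \<le> ln 4 * real n"
proof -
  have "(\<Sum>p\<in>primes_upto (real n). ln (real p)) = ln (real (\<Prod>(primes_upto (real n))))"
    by (subst of_nat_prod, subst ln_prod) (auto simp: primes_upto_def prime_gt_0_nat)
  also have "\<dots> \<le> ln (real (4 ^ n))"
    by (intro ln_mono of_nat_mono prod_primes_upto_le)
      (auto simp: primes_upto_def prime_gt_0_nat intro!: prod_pos)
  finally show ?thesis
    by (simp add: ln_realpow mult.commute)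
qed

section \<open>The prime factorization of n! and Mertens' first theorem\<close>

lemma multiplicity_fact_rec:
  fixes p :: nat
  assumes p: "prime p"
  shows "multiplicity p (fact n) = n div p + multiplicity p (fact (n div p))"
proof -
  have fact: "multiplicity p (fact m :: nat) = (\<Sum>i\<in>{1..m}. multiplicity p i)" for m
    using p unfolding fact_prod of_nat_id
    by (subst prime_elem_multiplicity_prod_distrib) (auto simp: prime_imp_prime_elem)
  have p0: "p > 0"
    using p by (simp add: prime_gt_0_nat)
  have "multiplicity p (fact n :: nat) = (\<Sum>i\<in>{i\<in>{1..n}. p dvd i}. multiplicity p i)"
    unfolding fact by (intro sum.mono_neutral_right) (auto simp: not_dvd_imp_multiplicity_0)
  \<comment> \<open>Each multiple p m contributes one more than the multiplicity of p in m, which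
    yields Legendre's formula in recursive form.\<close>
  also have "{i\<in>{1..n}. p dvd i} = (\<lambda>m. p * m) ` {1..n div p}"
    using p0 by (auto simp: less_eq_div_iff_mult_less_eq mult.commute elim!: dvdE)
  also have "(\<Sum>i\<in>\<dots>. multiplicity p i) = (\<Sum>i\<in>{1..n div p}. Suc (multiplicity p i))"
    using p p0 by (subst sum.reindex) (auto simp: inj_on_def multiplicity_times_same prime_nat_iff intro!: sum.cong)
  also have "\<dots> = n div p + multiplicity p (fact (n div p))"
    unfolding fact by (subst sum_Suc) simp
  finally show ?thesis .
qed

text \<open>The bound n/(p - 1) is the geometric series of the n/p^i, and so it is reproduced by the
  recursion: n/p + (n/p)/(p - 1) = n/(p - 1).\<close>

lemma multiplicity_fact_le:
  fixes p :: nat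
  assumes p: "prime p"
  shows "real (multiplicity p (fact n)) \<le> real n / (real p - 1)"
proof (induction n rule: less_induct)
  case (less n)
  have p1: "real p > 1"
    using p prime_gt_1_nat by simp
  show ?case
  proof (cases "n = 0")
    case False
    have "n div p < n"
      using False prime_gt_1_nat[OF p] by (intro div_less_dividend) auto
    have "real (multiplicity p (fact n)) = real (n div p) + real (multiplicity p (fact (n div p)))"
      using multiplicity_fact_rec[OF p, of n] by simp
    also have "\<dots> \<le> real (n div p) + real (n div p) / (real p - 1)"
      using less.IH[OF \<open>n div p < n\<close>] by simp
    also have "\<dots> \<le> real n / real p + (real n / real p) / (real p - 1)"
      using p1 by (intro add_mono divide_right_mono of_nat_div_le_of_nat) auto
    also have "\<dots> = real n / (real p - 1)"
      using p1 by (simp add: field_simps)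
    finally show ?thesis .
  qed simp
qed

lemma ln_fact_eq_sum_multiplicity:
  "ln (fact n) = (\<Sum>p\<in>primes_upto (real n). real (multiplicity p (fact n)) * ln (real p))"
proof -
  have "prime_factors (fact n :: nat) = primes_upto (real n)"
    by (auto simp: primes_upto_of_nat prime_factors_dvd prime_dvd_fact_iff)
  then have "fact n = real (\<Prod>p\<in>primes_upto (real n). p ^ multiplicity p (fact n))"
    using prod_prime_factors[of "fact n :: nat"] by (simp add: fact_nonzero)
  then have "ln (fact n) = ln (\<Prod>p\<in>primes_upto (real n). real p ^ multiplicity p (fact n))"
    by simp
  also have "\<dots> = (\<Sum>p\<in>primes_upto (real n). ln (real p ^ multiplicity p (fact n)))"
    by (intro ln_prod) (auto simp: primes_upto_def prime_gt_0_nat)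
  also have "\<dots> = (\<Sum>p\<in>primes_upto (real n). real (multiplicity p (fact n)) * ln (real p))"
    by (intro sum.cong) (auto simp: primes_upto_def prime_gt_0_nat ln_realpow)
  finally show ?thesis .
qed

text \<open>n^n/n! is a single term of the exponential series at n.\<close>

lemma ln_fact_ge: "n > 0 \<Longrightarrow> ln (fact n) \<ge> real n * ln (real n) - real n"
proof -
  assume n: "n > 0"
  have "(\<lambda>k. real n ^ k / fact k) sums exp (real n)"
    using exp_converges[of "real n"] by (simp add: divide_inverse_commute)
  then have "real n ^ n / fact n \<le> exp (real n)"
    using sum_le_suminf[of "\<lambda>k. real n ^ k / fact k" "{n}"] by (simp add: sums_iff)
  then have "ln (real n ^ n / fact n) \<le> ln (exp (real n))"
    using n by (intro ln_mono) auto
  then show ?thesis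
    using n by (simp add: ln_div ln_realpow)
qed

text \<open>Compare ln n!, which is n ln n + O(n), with its prime factorization. Multiplicities lie
  between n/p - 1 and n/(p - 1): the -1 costs the sum of ln p over primes, bounded by Chebyshev, and
  the excess of 1/(p - 1) over 1/p is summable against ln p.\<close>

lemma mertens_first:
  obtains K where "K \<ge> 0"
    "\<And>n. n \<ge> 1 \<Longrightarrow> \<bar>(\<Sum>p\<in>primes_upto (real n). ln (real p) / real p) - ln (real n)\<bar> \<le> K"
proof -
  \<comment> \<open>\<open>v p\<close> is ln p/(p - 1) - ln p/p at a prime; at 0 and 1 it is
    0.\<close>
  define v where "v = (\<lambda>m::nat. ln (real m) / (real m * (real m - 1)))"
  have v_nonneg: "v m \<ge> 0" for m
    by (cases "m = 0") (auto simp: v_def)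
  have "v \<in> O(\<lambda>m. real m powr (-3/2))"
    unfolding v_def by real_asymp
  then have v: "summable v"
    by (rule summable_comparison_test_bigo[rotated]) (auto simp: summable_real_powr_iff)
  define K where "K = max (ln 4) (1 + suminf v)"
  show ?thesis
  proof
    have "ln 4 \<ge> (0::real)"
      by simp
    then show "K \<ge> 0"
      unfolding K_def by linarith
    fix n :: nat assume n: "n \<ge> 1"
    define P where "P = primes_upto (real n)"
    define S where "S = (\<Sum>p\<in>P. ln (real p) / real p)"
    have P: "finite P" "\<And>p. p \<in> P \<Longrightarrow> prime p"
      by (auto simp: P_def prime_if_in_primes_upto)
    have p1: "real p > 1" if "p \<in> P" for p
      using P(2)[OF that] prime_gt_1_nat by simp
    have "real n * S - (\<Sum>p\<in>P. ln (real p)) = (\<Sum>p\<in>P. (real n / real p - 1) * ln (real p))"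
      by (simp add: S_def sum_distrib_left sum_subtractf algebra_simps)
    also have "\<dots> \<le> (\<Sum>p\<in>P. real (multiplicity p (fact n)) * ln (real p))"
    proof (intro sum_mono mult_right_mono)
      fix p assume p: "p \<in> P"
      have "real n / real p - 1 \<le> real (n div p)"
        using floor_divide_of_nat_eq[of n p, where 'a = real] by linarith
      also have "\<dots> \<le> real (multiplicity p (fact n))"
        using multiplicity_fact_rec[OF P(2)[OF p], of n] by simp
      finally show "real n / real p - 1 \<le> real (multiplicity p (fact n))" .
    qed (use p1 in \<open>force intro: ln_ge_zero\<close>)
    also have "\<dots> = ln (fact n)"
      by (simp add: P_def ln_fact_eq_sum_multiplicity)
    also have "\<dots> \<le> ln (real n ^ n)"
      using n fact_le_power[of n, where 'a = real] by (intro ln_mono) auto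
    also have "\<dots> = real n * ln (real n)"
      using n by (simp add: ln_realpow)
    finally have "real n * S \<le> real n * ln (real n) + ln 4 * real n"
      using sum_ln_primes_upto_le[of n] by (simp add: P_def)
    then have "real n * S \<le> real n * (ln (real n) + ln 4)"
      by (simp add: algebra_simps)
    then have upper: "S \<le> ln (real n) + ln 4"
      using n by simp
    have "real n * ln (real n) - real n \<le> (\<Sum>p\<in>P. real (multiplicity p (fact n)) * ln (real p))"
      using ln_fact_ge[of n] n by (simp add: P_def ln_fact_eq_sum_multiplicity)
    also have "\<dots> \<le> (\<Sum>p\<in>P. real n / (real p - 1) * ln (real p))"
      using p1 P(2) by (intro sum_mono mult_right_mono multiplicity_fact_le) (force intro: ln_ge_zero)+
    also have "\<dots> = (\<Sum>p\<in>P. real n * (ln (real p) / real p) + real n * v p)"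
    proof (intro sum.cong refl)
      fix p assume "p \<in> P"
      with p1 have "real p > 1"
        by blast
      then show "real n / (real p - 1) * ln (real p) = real n * (ln (real p) / real p) + real n * v p"
        by (simp add: v_def field_simps)
    qed
    also have "\<dots> = real n * (S + (\<Sum>p\<in>P. v p))"
      by (simp add: S_def sum.distrib sum_distrib_left algebra_simps)
    also have "\<dots> \<le> real n * (S + suminf v)"
      using P(1) v v_nonneg by (intro mult_left_mono add_left_mono sum_le_suminf) auto
    finally have "real n * (ln (real n) - 1) \<le> real n * (S + suminf v)"
      by (simp add: algebra_simps)
    then have "ln (real n) - 1 \<le> S + suminf v"
      using n by simp
    with upper show "\<bar>(\<Sum>p\<in>primes_upto (real n). ln (real p) / real p) - ln (real n)\<bar> \<le> K"
      unfolding S_def P_def K_def by linarith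
  qed
qed

text \<open>The intervals [Y n - w n, Y n + w n] are nested and shrink to a point. This gives a
  limit and a rate of convergence together, and so replaces partial summation with
  integrals.\<close>

lemma telescoping_bound_imp_limit:
  fixes Y w :: "nat \<Rightarrow> real"
  assumes step: "\<And>n. \<bar>Y (Suc n) - Y n\<bar> \<le> w n - w (Suc n)" and w: "w \<longlonglongrightarrow> 0"
  obtains l where "\<And>n. \<bar>Y n - l\<bar> \<le> w n"
proof -
  have "w (Suc n) \<le> w n" for n
    using step[of n] by linarith
  then have "decseq w"
    by (rule decseq_SucI)
  then have w_nonneg: "w n \<ge> 0" for n
    using w decseq_ge by blast
  have *: "Y n - w n \<le> Y (Suc n) - w (Suc n)" "Y (Suc n) + w (Suc n) \<le> Y n + w n" for n
    using step[of n] by linarith+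
  have "(\<lambda>n. (Y n - w n) - (Y n + w n)) \<longlonglongrightarrow> 0"
    using tendsto_mult_left[OF w, of "-2"] by simp
  then have "\<exists>l. ((\<forall>n. Y n - w n \<le> l) \<and> (\<lambda>n. Y n - w n) \<longlonglongrightarrow> l) \<and>
      ((\<forall>n. l \<le> Y n + w n) \<and> (\<lambda>n. Y n + w n) \<longlonglongrightarrow> l)"
    using * w_nonneg by (intro nested_sequence_unique) (auto intro: order_trans[of _ 0])
  then obtain l where "\<And>n. Y n - w n \<le> l" "\<And>n. l \<le> Y n + w n"
    by blast
  then have "\<bar>Y n - l\<bar> \<le> w n" for n
    by (smt (verit))
  then show ?thesis
    by (rule that)
qed

lemma mertens_second_nat:
  obtains M C where "C \<ge> 0"
    "\<And>n. n \<ge> 2 \<Longrightarrow> \<bar>(\<Sum>p\<in>primes_upto (real n). 1 / real p) - ln (ln (real n)) - M\<bar> \<le> C / ln (real n)"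
proof -
  obtain K where K: "K \<ge> 0"
    "\<And>n. n \<ge> 1 \<Longrightarrow> \<bar>(\<Sum>p\<in>primes_upto (real n). ln (real p) / real p) - ln (real n)\<bar> \<le> K"
    using mertens_first by blast
  define R where "R = (\<lambda>n::nat. (\<Sum>p\<in>primes_upto (real n). ln (real p) / real p) - ln (real n))"
  define S where "S = (\<lambda>n::nat. \<Sum>p\<in>primes_upto (real n). 1 / real p)"
  \<comment> \<open>Subtracting R n/ln n is the boundary term of partial summation. Without it a
    step would contain the increment of R, which is not bounded by the telescoping
    difference.\<close>
  define Y where "Y = (\<lambda>n::nat. S n - ln (ln (real n)) - R n / ln (real n))"
  have step: "\<bar>Y (Suc n) - Y n\<bar> \<le> (K + 1) / ln (real n) - (K + 1) / ln (real (Suc n))" if n: "n \<ge> 2" for n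
  proof -
    define a b where "a = ln (real n)" and "b = ln (real (Suc n))"
    have a: "a > 0" and ab: "a < b"
      using n by (auto simp: a_def b_def)
    have "b - a = ln (1 + 1 / real n)"
      using n ln_div[of "real (Suc n)" "real n"] by (simp add: a_def b_def add_divide_distrib add.commute)
    also have "\<dots> \<le> 1 / real n"
      by (intro ln_add_one_self_le_self) auto
    also have "\<dots> \<le> 1"
      using n by simp
    finally have ba: "b - a \<le> 1" .
    have notin: "Suc n \<notin> primes_upto (real n)"
      by (simp add: primes_upto_of_nat)
    have "S (Suc n) - S n = (R (Suc n) + b - (R n + a)) / b"
      using notin a ab unfolding S_def R_def primes_upto_Suc a_def[symmetric] b_def[symmetric]
      by (auto simp: b_def)
    then have "Y (Suc n) - Y n = (R (Suc n) + b - (R n + a)) / b - (ln b - ln a) -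
        (R (Suc n) / b - R n / a)"
      unfolding Y_def a_def[symmetric] b_def[symmetric] by simp
    also have "\<dots> = R n * (1 / a - 1 / b) + ((b - a) / b - (ln b - ln a))"
      using a ab by (simp add: field_simps)
    finally have Y: "Y (Suc n) - Y n = R n * (1 / a - 1 / b) + ((b - a) / b - (ln b - ln a))" .
    have w: "1 / a - 1 / b \<ge> 0"
      using a ab by (simp add: field_simps)
    have "\<bar>R n * (1 / a - 1 / b)\<bar> \<le> K * (1 / a - 1 / b)"
      unfolding abs_mult using K(2)[of n] w n by (intro mult_mono) (auto simp: R_def)
    \<comment> \<open>ln b - ln a lies between (b - a)/b and (b - a)/a, and these differ by (b -
      a)(1/a - 1/b) with b - a \<le> 1.\<close>
    moreover have "\<bar>(b - a) / b - (ln b - ln a)\<bar> \<le> 1 / a - 1 / b"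
    proof -
      have "ln b - ln a \<le> b / a - 1"
        using ln_le_minus_one[of "b / a"] a ab by (simp add: ln_div)
      moreover have "ln a - ln b \<le> a / b - 1"
        using ln_le_minus_one[of "a / b"] a ab by (simp add: ln_div)
      moreover have "(b - a) / b = 1 - a / b"
        using a ab by (simp add: field_simps)
      moreover have "(b / a - 1) - (1 - a / b) \<le> 1 / a - 1 / b"
      proof -
        have "(b / a - 1) - (1 - a / b) = (b - a) * (1 / a - 1 / b)"
          using a ab by (simp add: field_simps)
        also have "\<dots> \<le> 1 * (1 / a - 1 / b)"
          using ba w by (intro mult_right_mono) auto
        finally show ?thesis
          by simp
      qed
      ultimately show ?thesis
        by linarith
    qed
    moreover have "(K + 1) / a - (K + 1) / b = K * (1 / a - 1 / b) + (1 / a - 1 / b)"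
      by (simp add: add_divide_distrib right_diff_distrib)
    ultimately show ?thesis
      unfolding Y a_def[symmetric] b_def[symmetric] by linarith
  qed
  \<comment> \<open>The sequence is shifted to start at 2, where the logarithm is positive.\<close>
  have "(\<lambda>n. (K + 1) / ln (real (n + 2))) \<longlonglongrightarrow> 0"
    by real_asymp
  then obtain M where M: "\<And>n. \<bar>Y (n + 2) - M\<bar> \<le> (K + 1) / ln (real (n + 2))"
    using telescoping_bound_imp_limit[of "\<lambda>n. Y (n + 2)" "\<lambda>n. (K + 1) / ln (real (n + 2))"]
      step[of "n + 2" for n] by auto
  show ?thesis
  proof
    show "2 * K + 1 \<ge> 0"
      using K(1) by simp
    fix n :: nat assume n: "n \<ge> 2"
    have "\<bar>Y n - M\<bar> \<le> (K + 1) / ln (real n)"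
      using M[of "n - 2"] n by (simp only: le_add_diff_inverse2)
    moreover have "\<bar>R n / ln (real n)\<bar> \<le> K / ln (real n)"
      unfolding abs_divide using K(2)[of n] n by (auto simp: R_def intro!: divide_right_mono)
    moreover have "(2 * K + 1) / ln (real n) = (K + 1) / ln (real n) + K / ln (real n)"
      by (simp flip: add_divide_distrib)
    ultimately show "\<bar>(\<Sum>p\<in>primes_upto (real n). 1 / real p) - ln (ln (real n)) - M\<bar> \<le>
        (2 * K + 1) / ln (real n)"
      unfolding Y_def S_def by linarith
  qed
qed

lemma floor_ln_bounds:
  fixes y :: real
  assumes "y \<ge> 2"
  defines "n \<equiv> nat \<lfloor>y\<rfloor>"
  shows "n \<ge> 2" "ln (real n) > 0" "ln (real n) \<le> ln y" "ln y \<le> ln (real n) + 1" "ln y \<le> 2 * ln (real n)"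
proof -
  show n: "n \<ge> 2"
    using assms by (simp add: n_def le_nat_iff le_floor_iff)
  then show "ln (real n) > 0"
    by simp
  have le: "real n \<le> y" "y \<le> real n + 1"
    using assms unfolding n_def by linarith+
  with n show "ln (real n) \<le> ln y"
    by (intro ln_mono) auto
  have "ln y \<le> ln (real n * (1 + 1 / real n))"
    using le n by (intro ln_mono) (auto simp: distrib_left)
  also have "\<dots> = ln (real n) + ln (1 + 1 / real n)"
    using n by (intro ln_mult_pos) (auto intro: add_pos_pos)
  also have "ln (1 + 1 / real n) \<le> 1 / real n"
    by (intro ln_add_one_self_le_self) auto
  also have "1 / real n \<le> 1"
    using n by simp
  finally show "ln y \<le> ln (real n) + 1"
    by simp
  have "real n + 1 \<le> real n * 2"
    using n by simp
  also have "\<dots> \<le> real n * real n"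
    using n by (intro mult_left_mono) auto
  finally have "ln y \<le> ln (real n * real n)"
    using le assms(1) by (intro ln_mono) linarith+
  with n show "ln y \<le> 2 * ln (real n)"
    by (simp add: ln_mult_pos)
qed

lemma mertens_second:
  obtains M C where "C \<ge> 0"
    "\<And>y. y \<ge> 2 \<Longrightarrow> \<bar>(\<Sum>p\<in>primes_upto y. 1 / real p) - ln (ln y) - M\<bar> \<le> C / ln y"
proof -
  obtain M C where C: "C \<ge> 0"
    "\<And>n. n \<ge> 2 \<Longrightarrow> \<bar>(\<Sum>p\<in>primes_upto (real n). 1 / real p) - ln (ln (real n)) - M\<bar> \<le> C / ln (real n)"
    using mertens_second_nat by blast
  show ?thesis
  proof
    show "2 * (C + 1) \<ge> 0"
      using C(1) by simp
    fix y :: real assume y: "y \<ge> 2"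
    define n where "n = nat \<lfloor>y\<rfloor>"
    note n = floor_ln_bounds[OF y, folded n_def]
    have S: "primes_upto y = primes_upto (real n)"
      using primes_upto_floor[of y] y by (simp add: n_def)
    have "ln (ln y) - ln (ln (real n)) \<le> ln y / ln (real n) - 1"
      using ln_le_minus_one[of "ln y / ln (real n)"] n y by (simp add: ln_div)
    also have "\<dots> \<le> (ln (real n) + 1) / ln (real n) - 1"
      using n by (intro diff_right_mono divide_right_mono) auto
    also have "\<dots> = 1 / ln (real n)"
      using n(2) by (simp add: add_divide_distrib)
    finally have "\<bar>ln (ln y) - ln (ln (real n))\<bar> \<le> 1 / ln (real n)"
      using n(2,3) ln_mono[of "ln (real n)" "ln y"] by simp
    with C(2)[OF n(1)]
    have "\<bar>(\<Sum>p\<in>primes_upto y. 1 / real p) - ln (ln y) - M\<bar> \<le> C / ln (real n) + 1 / ln (real n)"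
      unfolding S by linarith
    also have "\<dots> = 2 * (C + 1) / (2 * ln (real n))"
      using n by (simp add: field_simps)
    also have "\<dots> \<le> 2 * (C + 1) / ln y"
      using n y C by (intro divide_left_mono) auto
    finally show "\<bar>(\<Sum>p\<in>primes_upto y. 1 / real p) - ln (ln y) - M\<bar> \<le> 2 * (C + 1) / ln y" .
  qed
qed

text \<open>With p = n + 1 a term is at most C/n^2, which is dominated by the telescoping 2C/n -
  2C/(n+1). This one tail estimate serves Mertens' third theorem, the Euler product of zeta and the
  product for \<open>F\<close>.\<close>

lemma sum_over_primes_tail:
  fixes f :: "nat \<Rightarrow> real"
  assumes f: "\<And>p. prime p \<Longrightarrow> \<bar>f p\<bar> \<le> C / (real p - 1)\<^sup>2" and C: "C \<ge> 0"
  defines "g \<equiv> \<lambda>n. if prime n then f n else 0"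
  shows "summable g" and "(\<lambda>n. \<Sum>p\<in>primes_upto (real n). f p) \<longlonglongrightarrow> suminf g"
    and "\<And>y. y \<ge> 2 \<Longrightarrow> \<bar>(\<Sum>p\<in>primes_upto y. f p) - suminf g\<bar> \<le> 4 * C / y"
proof -
  define Y where "Y = (\<lambda>n. \<Sum>p\<in>primes_upto (real n). f p)"
  have Y: "Y n = (\<Sum>i\<le>n. g i)" for n
    unfolding Y_def g_def primes_upto_of_nat sum.inter_filter[symmetric, OF finite_atMost]
    by (intro sum.cong) auto
  have step: "\<bar>Y (Suc n) - Y n\<bar> \<le> 2 * C / real n - 2 * C / real (Suc n)" if n: "n \<ge> 1" for n
  proof -
    have "\<bar>Y (Suc n) - Y n\<bar> \<le> C / (real n)\<^sup>2"
      using f[of "Suc n"] C by (auto simp: Y g_def)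
    also have "\<dots> \<le> C * (2 / (real n * real (Suc n)))"
    proof -
      have "1 / (real n * real n) \<le> 2 / (real n * real (Suc n))"
        using n by (simp add: divide_simps)
      then have "C * (1 / (real n * real n)) \<le> C * (2 / (real n * real (Suc n)))"
        using C by (rule mult_left_mono)
      then show ?thesis
        by (simp add: power2_eq_square)
    qed
    also have "\<dots> = 2 * C / real n - 2 * C / real (Suc n)"
      using n by (simp add: divide_simps) (simp add: algebra_simps)
    finally show ?thesis .
  qed
  have "(\<lambda>n. 2 * C / real (n + 1)) \<longlonglongrightarrow> 0"
    by real_asymp
  then obtain l where l: "\<And>n. \<bar>Y (n + 1) - l\<bar> \<le> 2 * C / real (n + 1)"
    using telescoping_bound_imp_limit[of "\<lambda>n. Y (n + 1)" "\<lambda>n. 2 * C / real (n + 1)"]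
      step[of "n + 1" for n] by auto
  have "(\<lambda>n. Y (n + 1) - l) \<longlonglongrightarrow> 0"
    by (rule Lim_null_comparison[OF _ \<open>(\<lambda>n. 2 * C / real (n + 1)) \<longlonglongrightarrow> 0\<close>]) (use l in simp)
  then have "(\<lambda>n. Y (n + 1)) \<longlonglongrightarrow> l"
    by (simp add: LIM_zero_iff)
  then have Yl: "Y \<longlonglongrightarrow> l"
    by (rule LIMSEQ_offset)
  then have "g sums l"
    by (simp add: sums_def_le flip: Y)
  then have gl: "summable g" "suminf g = l"
    by (auto simp: sums_iff)
  then show "summable g" "(\<lambda>n. \<Sum>p\<in>primes_upto (real n). f p) \<longlonglongrightarrow> suminf g"
    using Yl by (auto simp: Y_def)
  fix y :: real assume y: "y \<ge> 2"
  define n where "n = nat \<lfloor>y\<rfloor>"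
  have n: "real n \<ge> y / 2" "n \<ge> 1"
    using y unfolding n_def by linarith+
  have "\<bar>Y n - l\<bar> \<le> 2 * C / real n"
    using l[of "n - 1"] n by simp
  also have "\<dots> \<le> 2 * C / (y / 2)"
    using n y C by (intro divide_left_mono) auto
  also have "Y n = (\<Sum>p\<in>primes_upto y. f p)"
    using primes_upto_floor[of y] y by (simp add: Y_def n_def)
  finally show "\<bar>(\<Sum>p\<in>primes_upto y. f p) - suminf g\<bar> \<le> 4 * C / y"
    by (simp add: gl)
qed

section \<open>The zeta function near 1 and its Euler product\<close>

lemma powr_telescope_bounds:
  fixes \<epsilon> :: real
  assumes "\<epsilon> > 0"
  shows "n \<ge> 1 \<Longrightarrow> real n powr -\<epsilon> - real (Suc n) powr -\<epsilon> \<le> \<epsilon> * real n powr (-1-\<epsilon>)"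
    and "n \<ge> 1 \<Longrightarrow> \<epsilon> * real (Suc n) powr (-1-\<epsilon>) \<le> real n powr -\<epsilon> - real (Suc n) powr -\<epsilon>"
proof -
  assume n: "n \<ge> 1"
  have eq: "real m powr (-1-\<epsilon>) = real m powr -\<epsilon> * (1 / real m)" if "m > 0" for m
    using that powr_add[of "real m" "-\<epsilon>" "-1"] by (simp add: powr_minus_divide algebra_simps)
  have ln: "ln (real (Suc n)) - ln (real n) = ln (1 + 1 / real n)"
    using n ln_div[of "real (Suc n)" "real n"] by (simp add: add_divide_distrib add.commute)
  have ln': "ln (real n) - ln (real (Suc n)) = ln (1 - 1 / real (Suc n))"
    using n ln_div[of "real n" "real (Suc n)"] by (simp add: field_simps)
  \<comment> \<open>Both bounds are mean value estimates for t^(-\<epsilon>), obtained from e^t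
    \<ge> 1 + t.\<close>
  have "real (Suc n) powr -\<epsilon> = real n powr -\<epsilon> * exp (-\<epsilon> * (ln (real (Suc n)) - ln (real n)))"
    using n by (simp add: powr_def algebra_simps flip: exp_add)
  also have "\<dots> \<ge> real n powr -\<epsilon> * (1 + -\<epsilon> * (ln (real (Suc n)) - ln (real n)))"
    by (intro mult_left_mono exp_ge_add_one_self) auto
  finally have 1: "real (Suc n) powr -\<epsilon> \<ge> real n powr -\<epsilon> * (1 - \<epsilon> * ln (1 + 1 / real n))"
    unfolding ln by simp
  have "\<epsilon> * ln (1 + 1 / real n) \<le> \<epsilon> * (1 / real n)"
    using assms by (intro mult_left_mono ln_add_one_self_le_self) auto
  then have "real n powr -\<epsilon> * (1 - \<epsilon> * (1 / real n)) \<le> real n powr -\<epsilon> * (1 - \<epsilon> * ln (1 + 1 / real n))"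
    by (intro mult_left_mono) auto
  with 1 show "real n powr -\<epsilon> - real (Suc n) powr -\<epsilon> \<le> \<epsilon> * real n powr (-1-\<epsilon>)"
    using n by (simp add: eq algebra_simps)
  have "real n powr -\<epsilon> = real (Suc n) powr -\<epsilon> * exp (-\<epsilon> * (ln (real n) - ln (real (Suc n))))"
    using n by (simp add: powr_def algebra_simps flip: exp_add)
  also have "\<dots> \<ge> real (Suc n) powr -\<epsilon> * (1 + -\<epsilon> * (ln (real n) - ln (real (Suc n))))"
    by (intro mult_left_mono exp_ge_add_one_self) auto
  finally have 2: "real n powr -\<epsilon> \<ge> real (Suc n) powr -\<epsilon> * (1 - \<epsilon> * ln (1 - 1 / real (Suc n)))"
    unfolding ln' by simp
  have "ln (1 - 1 / real (Suc n)) \<le> - (1 / real (Suc n))"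
    using n ln_le_minus_one[of "1 - 1 / real (Suc n)"] by simp
  then have "\<epsilon> * ln (1 - 1 / real (Suc n)) \<le> \<epsilon> * - (1 / real (Suc n))"
    using assms by (intro mult_left_mono) auto
  then have "real (Suc n) powr -\<epsilon> * (1 + \<epsilon> * (1 / real (Suc n))) \<le>
      real (Suc n) powr -\<epsilon> * (1 - \<epsilon> * ln (1 - 1 / real (Suc n)))"
    by (intro mult_left_mono) auto
  with 2 show "\<epsilon> * real (Suc n) powr (-1-\<epsilon>) \<le> real n powr -\<epsilon> - real (Suc n) powr -\<epsilon>"
    using eq[of "Suc n"] by (simp add: algebra_simps)
qed

text \<open>This is zeta(1 + \<epsilon>), parametrized by the distance to the pole.\<close>

definition zeta1p :: "real \<Rightarrow> real" where
  "zeta1p \<epsilon> = (\<Sum>n. real (Suc n) powr (-1-\<epsilon>))"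

lemma zeta1p_summable:
  assumes "\<epsilon> > 0"
  shows "summable (\<lambda>n. real (Suc n) powr (-1-\<epsilon>))"
  using assms summable_Suc_iff[of "\<lambda>n. real n powr (-1-\<epsilon>)"] by (simp add: summable_real_powr_iff)

text \<open>Summing the telescoping bounds replaces the integral test and pins down the simple pole
  with residue 1.\<close>

lemma zeta1p_bounds:
  assumes "\<epsilon> > 0"
  shows "1 \<le> \<epsilon> * zeta1p \<epsilon>" "\<epsilon> * zeta1p \<epsilon> \<le> 1 + \<epsilon>"
proof -
  note s = zeta1p_summable[OF assms]
  have lim: "(\<lambda>n. real (Suc n) powr -\<epsilon>) \<longlonglongrightarrow> 0"
    using assms by real_asymp
  have tel: "(\<lambda>n. real (Suc n) powr -\<epsilon> - real (Suc (Suc n)) powr -\<epsilon>) sums 1"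
    using telescope_sums'[OF lim] by simp
  have "1 \<le> (\<Sum>n. \<epsilon> * real (Suc n) powr (-1-\<epsilon>))"
    by (intro sums_le[OF _ tel summable_sums[OF summable_mult[OF s]]] powr_telescope_bounds(1) assms) simp
  then show "1 \<le> \<epsilon> * zeta1p \<epsilon>"
    unfolding zeta1p_def suminf_mult[OF s] .
  have s2: "summable (\<lambda>n. real (Suc (Suc n)) powr (-1-\<epsilon>))"
    using s summable_Suc_iff[of "\<lambda>n. real (Suc n) powr (-1-\<epsilon>)"] by blast
  have "(\<Sum>n. \<epsilon> * real (Suc (Suc n)) powr (-1-\<epsilon>)) \<le> 1"
    by (intro sums_le[OF _ summable_sums[OF summable_mult[OF s2]] tel] powr_telescope_bounds(2) assms) simp
  moreover have "zeta1p \<epsilon> = 1 + (\<Sum>n. real (Suc (Suc n)) powr (-1-\<epsilon>))"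
    using suminf_split_head[OF s] by (simp add: zeta1p_def)
  ultimately show "\<epsilon> * zeta1p \<epsilon> \<le> 1 + \<epsilon>"
    unfolding suminf_mult[OF s2] by (simp add: distrib_left)
qed

text \<open>The sieve of Eratosthenes: multiplication by a new prime q maps the numbers free of
  \<open>P\<close> into themselves, and removing its image multiplies the sum by 1 -
  q^(-1-\<epsilon>).\<close>

lemma has_sum_coprime_to_primes:
  assumes s: "\<epsilon> > 0" and P: "finite P" "\<And>p. p \<in> P \<Longrightarrow> prime p"
  shows "((\<lambda>n. real n powr (-1-\<epsilon>)) has_sum zeta1p \<epsilon> * (\<Prod>p\<in>P. 1 - real p powr (-1-\<epsilon>)))
    {n. n \<ge> 1 \<and> (\<forall>p\<in>P. \<not> p dvd n)}"
  using P
proof (induction P rule: finite_induct)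
  case empty
  have "((\<lambda>n. real (Suc n) powr (-1-\<epsilon>)) has_sum zeta1p \<epsilon>) UNIV"
    unfolding zeta1p_def using zeta1p_summable[OF s]
    by (intro norm_summable_imp_has_sum summable_sums) auto
  then have "((\<lambda>n. real n powr (-1-\<epsilon>)) has_sum zeta1p \<epsilon>) (range Suc)"
    by (subst has_sum_reindex) (auto simp: o_def)
  also have "range Suc = {n. n \<ge> 1}"
    by (auto simp: image_iff Suc_le_eq gr0_conv_Suc)
  finally show ?case
    by simp
next
  case (insert q P)
  define A where "A = {n. n \<ge> 1 \<and> (\<forall>p\<in>P. \<not> p dvd n)}"
  define z where "z = zeta1p \<epsilon> * (\<Prod>p\<in>P. 1 - real p powr (-1-\<epsilon>))"
  have A: "((\<lambda>n. real n powr (-1-\<epsilon>)) has_sum z) A"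
    using insert by (simp add: A_def z_def)
  have q: "prime q" "q > 0"
    using insert.prems[of q] by (auto simp: prime_gt_0_nat)
  have dvd: "p dvd q * n \<longleftrightarrow> p dvd n" if "p \<in> P" for p n
  proof -
    have "prime p" "p \<noteq> q"
      using insert that by auto
    then have "\<not> p dvd q"
      using q primes_dvd_imp_eq by blast
    then show ?thesis
      using \<open>prime p\<close> by (simp add: prime_dvd_mult_iff)
  qed
  have sub: "(\<lambda>n. q * n) ` A \<subseteq> A"
    using q by (auto simp: A_def dvd Suc_le_eq)
  have "((\<lambda>n. real (q * n) powr (-1-\<epsilon>)) has_sum real q powr (-1-\<epsilon>) * z) A"
    using has_sum_cmult_right[OF A, of "real q powr (-1-\<epsilon>)"] by (simp add: powr_mult)
  then have "((\<lambda>n. real n powr (-1-\<epsilon>)) has_sum real q powr (-1-\<epsilon>) * z) ((\<lambda>n. q * n) ` A)"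
    using q by (subst has_sum_reindex) (auto simp: o_def inj_on_def)
  from has_sum_Diff[OF A this sub]
  have "((\<lambda>n. real n powr (-1-\<epsilon>)) has_sum (z - real q powr (-1-\<epsilon>) * z)) (A - (\<lambda>n. q * n) ` A)" .
  moreover have "A - (\<lambda>n. q * n) ` A = {n. n \<ge> 1 \<and> (\<forall>p\<in>insert q P. \<not> p dvd n)}"
    using q by (auto simp: A_def dvd Suc_le_eq elim!: dvdE)
  moreover have "z - real q powr (-1-\<epsilon>) * z =
      zeta1p \<epsilon> * (\<Prod>p\<in>insert q P. 1 - real p powr (-1-\<epsilon>))"
    using insert.hyps by (simp add: z_def algebra_simps)
  ultimately show ?case
    by simp
qed

text \<open>After sieving by the primes up to N, the number 1 survives and every other survivor
  exceeds N. The sum is squeezed between 1 and 1 plus a tail of the zeta series.\<close>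

lemma euler_product_zeta1p:
  assumes s: "\<epsilon> > 0"
  shows "(\<lambda>N. zeta1p \<epsilon> * (\<Prod>p\<in>primes_upto (real N). 1 - real p powr (-1-\<epsilon>))) \<longlonglongrightarrow> 1"
proof (rule tendsto_sandwich)
  define f where "f = (\<lambda>n. real n powr (-1-\<epsilon>))"
  define z where "z = (\<lambda>N. zeta1p \<epsilon> * (\<Prod>p\<in>primes_upto (real N). 1 - real p powr (-1-\<epsilon>)))"
  define A where "A = (\<lambda>N. {n. n \<ge> 1 \<and> (\<forall>p\<in>primes_upto (real N). \<not> p dvd n)})"
  have z: "(f has_sum z N) (A N)" for N
    unfolding f_def z_def A_def
    by (intro has_sum_coprime_to_primes) (use s in \<open>auto simp: prime_if_in_primes_upto\<close>)
  have 1: "(f has_sum zeta1p \<epsilon>) {1..}"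
    using has_sum_coprime_to_primes[OF s, of "{}"] by (simp add: f_def atLeast_def)
  have one: "(f has_sum 1) {1}"
    using has_sum_finite[of "{1}" f] by (simp add: f_def)
  have "z N \<ge> 1" for N
  proof (rule has_sum_mono_neutral[OF one z[of N]])
    fix n assume "n \<in> {1} - A N"
    moreover have "1 \<in> A N"
      by (auto simp: A_def primes_upto_def)
    ultimately show "f n \<le> 0"
      by auto
  qed (auto simp: f_def)
  then show "\<forall>\<^sub>F N in sequentially. 1 \<le> zeta1p \<epsilon> * (\<Prod>p\<in>primes_upto (real N). 1 - real p powr (-1-\<epsilon>))"
    by (simp add: z_def)
  have "z N \<le> 1 + (zeta1p \<epsilon> - (\<Sum>n\<in>{1..N}. f n))" if "N \<ge> 1" for N
  proof -
    have "(f has_sum (zeta1p \<epsilon> - (\<Sum>n\<in>{1..N}. f n))) ({1..} - {1..N})"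
      by (rule has_sum_Diff[OF 1 has_sum_finite]) auto
    then have "(f has_sum (1 + (zeta1p \<epsilon> - (\<Sum>n\<in>{1..N}. f n)))) ({1} \<union> ({1..} - {1..N}))"
      using that by (intro has_sum_Un_disjoint[OF one]) auto
    then show ?thesis
    proof (rule has_sum_mono_neutral[OF z[of N]])
      fix n assume n: "n \<in> A N - ({1} \<union> ({1..} - {1..N}))"
      then have n': "n \<noteq> 1" "n \<le> N" "n \<in> A N"
        by (auto simp: A_def)
      then obtain p where p: "prime p" "p dvd n"
        using prime_factor_nat by blast
      have "n \<ge> 1"
        using n' by (simp add: A_def)
      then have "p \<le> N"
        using p n' dvd_imp_le[of p n] by linarith
      then have "p \<in> primes_upto (real N)"
        using p by (simp add: primes_upto_of_nat)
      then show "f n \<le> 0"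
        using n' p by (auto simp: A_def)
    qed (auto simp: f_def)
  qed
  then show "\<forall>\<^sub>F N in sequentially. zeta1p \<epsilon> * (\<Prod>p\<in>primes_upto (real N). 1 - real p powr (-1-\<epsilon>))
      \<le> 1 + (zeta1p \<epsilon> - (\<Sum>n\<in>{1..N}. f n))"
    unfolding z_def by (intro eventually_sequentiallyI[of 1])
  have "(\<lambda>N. \<Sum>n<N. f (Suc n)) \<longlonglongrightarrow> zeta1p \<epsilon>"
    unfolding zeta1p_def f_def using zeta1p_summable[OF s] summable_LIMSEQ by blast
  moreover have "(\<Sum>n<N. f (Suc n)) = (\<Sum>n\<in>{1..N}. f n)" for N
    by (rule sum.reindex_bij_witness[of _ "\<lambda>n. n - 1" Suc]) auto
  ultimately have "(\<lambda>N. \<Sum>n\<in>{1..N}. f n) \<longlonglongrightarrow> zeta1p \<epsilon>"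
    by simp
  then show "(\<lambda>N. 1 + (zeta1p \<epsilon> - (\<Sum>n\<in>{1..N}. f n))) \<longlonglongrightarrow> 1"
    by (auto intro!: tendsto_eq_intros)
qed auto

text \<open>Summation by parts writes the difference to l as (1 - z) times the power series of the
  errors e n of the partial sums. A finite head is killed by 1 - z, and the tail is small because e
  n is.\<close>

lemma abel_limit:
  fixes d :: "nat \<Rightarrow> real"
  assumes d: "d sums l"
  shows "((\<lambda>z. \<Sum>n. d n * z ^ n) \<longlongrightarrow> l) (at_left 1)"
proof -
  define e where "e = (\<lambda>n. (\<Sum>i\<le>n. d i) - l)"
  have e: "e \<longlonglongrightarrow> 0"
    using d unfolding e_def sums_def_le by (simp add: LIM_zero_iff)
  have main: "(\<Sum>n. d n * z ^ n) - l = (1 - z) * (\<Sum>n. e n * z ^ n)"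
      and summ: "summable (\<lambda>n. \<bar>e n\<bar> * z ^ n)" if z: "0 < z" "z < 1" for z
  proof -
    obtain B where B: "\<And>n. \<bar>e n\<bar> \<le> B"
      using convergent_imp_Bseq[OF convergentI[OF e]] by (auto simp: Bseq_def)
    show se: "summable (\<lambda>n. \<bar>e n\<bar> * z ^ n)"
    proof (rule summable_comparison_test'[of "\<lambda>n. B * z ^ n" 0])
      show "summable (\<lambda>n. B * z ^ n)"
        using z by (intro summable_mult summable_geometric) auto
      show "norm (\<bar>e n\<bar> * z ^ n) \<le> B * z ^ n" for n
        using B[of n] z by (auto intro!: mult_right_mono)
    qed
    then have se': "summable (\<lambda>n. e n * z ^ n)"
      by (rule summable_rabs_cancel[OF summable_cong[THEN iffD1], rotated])
        (use z in \<open>auto simp: abs_mult\<close>)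
    have ses: "summable (\<lambda>n. e n * z ^ Suc n)"
      using summable_mult[OF se', of z] by (simp add: mult_ac)
    have ses': "(\<Sum>n. e n * z ^ Suc n) = z * (\<Sum>n. e n * z ^ n)"
      using suminf_mult[OF se', of z] by (simp add: mult_ac)
    \<comment> \<open>d n is e n minus the preceding error, and -l is the error of the empty partial
      sum.\<close>
    have "d n * z ^ n = e n * z ^ n - (if n = 0 then - l else e (n - 1) * z ^ n)" for n
      by (cases n) (auto simp: e_def algebra_simps)
    moreover have "(\<lambda>n. if n = 0 then - l else e (n - 1) * z ^ n) sums (z * (\<Sum>n. e n * z ^ n) - l)"
      using sums_Suc[of "\<lambda>n. if n = 0 then - l else e (n - 1) * z ^ n"] summable_sums[OF ses] ses'
      by simp
    ultimately have "(\<lambda>n. d n * z ^ n) sums ((\<Sum>n. e n * z ^ n) - (z * (\<Sum>n. e n * z ^ n) - l))"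
      using sums_diff[OF summable_sums[OF se']] by presburger
    then show "(\<Sum>n. d n * z ^ n) - l = (1 - z) * (\<Sum>n. e n * z ^ n)"
      by (simp add: sums_iff algebra_simps)
  qed
  have "((\<lambda>z. (\<Sum>n. d n * z ^ n) - l) \<longlongrightarrow> 0) (at_left 1)"
  proof (rule tendstoI)
    fix \<eta> :: real assume \<eta>: "\<eta> > 0"
    obtain N where N: "\<And>n. n \<ge> N \<Longrightarrow> \<bar>e n\<bar> < \<eta> / 2"
      using LIMSEQ_D[OF e, of "\<eta> / 2"] \<eta> by auto
    define B where "B = (\<Sum>n<N. \<bar>e n\<bar>)"
    have "((\<lambda>z. (1 - z) * B) \<longlongrightarrow> 0) (at_left 1)"
      by (auto intro!: tendsto_eq_intros)
    then have "eventually (\<lambda>z. (1 - z) * B < \<eta> / 2) (at_left 1)"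
      using \<eta> by (intro order_tendstoD(2)) auto
    moreover have "eventually (\<lambda>z. z \<in> {0<..<1}) (at_left (1::real))"
      by (rule eventually_at_left_real) simp
    ultimately show "eventually (\<lambda>z. dist ((\<Sum>n. d n * z ^ n) - l) 0 < \<eta>) (at_left 1)"
    proof eventually_elim
      case (elim z)
      then have z: "0 < z" "z < 1"
        by auto
      note se = summ[OF z]
      have geo: "(\<lambda>n. \<eta> / 2 * z ^ n) sums (\<eta> / 2 * (1 / (1 - z)))"
        using z by (intro sums_mult geometric_sums) auto
      have "\<bar>\<Sum>n. e n * z ^ n\<bar> \<le> (\<Sum>n. \<bar>e n\<bar> * z ^ n)"
        using summable_rabs[of "\<lambda>n. e n * z ^ n"] se z by (simp add: abs_mult)
      also have "\<dots> \<le> B + \<eta> / 2 * (1 / (1 - z))"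
      proof -
        have "(\<lambda>n. if n \<in> {..<N} then \<bar>e n\<bar> else 0) sums B"
          unfolding B_def by (rule sums_If_finite_set) simp
        from sums_add[OF this geo] show ?thesis
        proof (rule sums_le[OF _ summable_sums[OF se], rotated])
          fix n
          have "\<bar>e n\<bar> * z ^ n \<le> \<bar>e n\<bar>"
            using z power_le_one[of z n] by (simp add: mult_left_le)
          moreover have "\<bar>e n\<bar> * z ^ n \<le> \<eta> / 2 * z ^ n" if "n \<ge> N"
            using N[OF that] z by (intro mult_right_mono) auto
          moreover have "\<eta> / 2 * z ^ n \<ge> 0"
            using z \<eta> by simp
          ultimately show "\<bar>e n\<bar> * z ^ n \<le> (if n \<in> {..<N} then \<bar>e n\<bar> else 0) + \<eta> / 2 * z ^ n"
            by (cases "n < N") auto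
        qed
      qed
      finally have "(1 - z) * \<bar>\<Sum>n. e n * z ^ n\<bar> \<le> (1 - z) * (B + \<eta> / 2 * (1 / (1 - z)))"
        using z by (intro mult_left_mono) auto
      also have "\<dots> = (1 - z) * B + \<eta> / 2"
        using z by (simp add: field_simps)
      also have "\<dots> < \<eta>"
        using elim by linarith
      finally show ?case
        using z by (simp add: main[OF z] dist_norm abs_mult)
    qed
  qed
  then show ?thesis
    by (simp add: LIM_zero_iff)
qed

section \<open>From the Euler product to sums over primes\<close>

lemma neg_ln_one_minus_bounds:
  fixes t :: real
  assumes "0 \<le> t" "t \<le> 1/2"
  shows "0 \<le> - ln (1 - t) - t" "- ln (1 - t) - t \<le> 2 * t\<^sup>2"
  using ln_one_minus_pos_lower_bound[OF assms] ln_le_minus_one[of "1 - t"] assms by auto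

lemma prime_powr_bounds:
  fixes \<epsilon> :: real
  assumes "prime (p::nat)" "\<epsilon> \<ge> 0"
  shows "0 < real p powr (-1-\<epsilon>)" "real p powr (-1-\<epsilon>) \<le> 1 / real p" "real p powr (-1-\<epsilon>) \<le> 1 / 2"
proof -
  have p: "real p \<ge> 2"
    using prime_ge_2_nat[OF assms(1)] by simp
  then show "0 < real p powr (-1-\<epsilon>)"
    by simp
  have "real p powr (-1-\<epsilon>) \<le> real p powr -1"
    using p assms(2) by (intro powr_mono) auto
  then show *: "real p powr (-1-\<epsilon>) \<le> 1 / real p"
    using p by (simp add: powr_minus_divide)
  have "1 / real p \<le> 1 / 2"
    using p by simp
  with * show "real p powr (-1-\<epsilon>) \<le> 1 / 2"
    by linarith
qed

text \<open>For prime p this is the part of -ln(1 - p^(-1-\<epsilon>)) coming from the powers p^j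
  with j \<ge> 2. It is quadratically small, so its sum over primes remains convergent at \<epsilon>
  = 0.\<close>

definition prime_log_defect :: "real \<Rightarrow> nat \<Rightarrow> real" where
  "prime_log_defect \<epsilon> p = - ln (1 - real p powr (-1-\<epsilon>)) - real p powr (-1-\<epsilon>)"

lemma prime_log_defect_bound:
  assumes "prime p" "\<epsilon> \<ge> 0"
  shows "\<bar>prime_log_defect \<epsilon> p\<bar> \<le> 2 / (real p)\<^sup>2" "\<bar>prime_log_defect \<epsilon> p\<bar> \<le> 2 / (real p - 1)\<^sup>2"
proof -
  define t where "t = real p powr (-1-\<epsilon>)"
  have t: "0 < t" "t \<le> 1 / real p" "t \<le> 1 / 2"
    unfolding t_def by (intro prime_powr_bounds assms)+
  have p: "real p \<ge> 2"
    using prime_ge_2_nat[OF assms(1)] by simp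
  have "\<bar>prime_log_defect \<epsilon> p\<bar> \<le> 2 * t\<^sup>2"
    using neg_ln_one_minus_bounds[of t] t by (simp add: prime_log_defect_def t_def)
  also have "\<dots> \<le> 2 * (1 / real p)\<^sup>2"
    using t by (intro mult_left_mono power_mono) auto
  finally show *: "\<bar>prime_log_defect \<epsilon> p\<bar> \<le> 2 / (real p)\<^sup>2"
    by (simp add: power_divide)
  also have "\<dots> \<le> 2 / (real p - 1)\<^sup>2"
    using p by (intro divide_left_mono power_mono mult_pos_pos) auto
  finally show "\<bar>prime_log_defect \<epsilon> p\<bar> \<le> 2 / (real p - 1)\<^sup>2" .
qed

definition prime_log_defect_sum :: "real \<Rightarrow> real" where
  "prime_log_defect_sum \<epsilon> = (\<Sum>n. if prime n then prime_log_defect \<epsilon> n else 0)"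

text \<open>Dominated convergence in the form of Tannery's theorem, with the majorant 2/n^2 that is
  independent of \<epsilon>.\<close>

lemma prime_log_defect_sum_tendsto:
  "(prime_log_defect_sum \<longlongrightarrow> prime_log_defect_sum 0) (at_right 0)"
proof -
  let ?a = "\<lambda>n \<epsilon>. if prime n then prime_log_defect \<epsilon> n else 0"
  have ev: "eventually (\<lambda>\<epsilon>. \<epsilon> > 0) (at_right (0::real))"
    by (rule eventually_at_right_less)
  have "((\<lambda>\<epsilon>. \<Sum>n. ?a n \<epsilon>) \<longlongrightarrow> (\<Sum>n. ?a n 0)) (at_right 0)"
  proof (rule tannerys_theorem[THEN conjunct2, THEN conjunct2])
    fix n
    show "((\<lambda>\<epsilon>. ?a n \<epsilon>) \<longlongrightarrow> ?a n 0) (at_right 0)"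
    proof (cases "prime n")
      case True
      then have "real n > 1"
        using prime_gt_1_nat by simp
      then have "((\<lambda>\<epsilon>. prime_log_defect \<epsilon> n) \<longlongrightarrow> prime_log_defect 0 n) (at_right 0)"
        unfolding prime_log_defect_def
        by (auto intro!: tendsto_eq_intros simp: powr_minus_divide)
      with True show ?thesis
        by simp
    qed simp
  next
    have "eventually (\<lambda>x. 0 < snd x) (at_top \<times>\<^sub>F at_right (0::real))"
      using filterlim_snd ev by (rule eventually_compose_filterlim[rotated])
    then show "\<forall>\<^sub>F (n, \<epsilon>) in at_top \<times>\<^sub>F at_right 0. norm (?a n \<epsilon>) \<le> 2 * (1 / (real n)\<^sup>2)"
      by eventually_elim (auto intro!: prime_log_defect_bound)
    show "summable (\<lambda>n. 2 * (1 / (real n)\<^sup>2))"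
      using inverse_power_summable[of 2, where 'a = real]
      by (intro summable_mult) (simp add: divide_inverse)
  qed auto
  then show ?thesis
    by (simp add: prime_log_defect_sum_def[abs_def])
qed

lemma ln_zeta1p_tendsto: "((\<lambda>\<epsilon>. ln (zeta1p \<epsilon>) + ln \<epsilon>) \<longlongrightarrow> 0) (at_right 0)"
proof (rule tendsto_sandwich)
  have "0 \<le> ln (zeta1p \<epsilon>) + ln \<epsilon> \<and> ln (zeta1p \<epsilon>) + ln \<epsilon> \<le> ln (1 + \<epsilon>)" if "\<epsilon> > 0" for \<epsilon>
  proof -
    note b = zeta1p_bounds[OF that]
    have "zeta1p \<epsilon> > 0"
      using b(1) that by (metis less_le_trans zero_less_mult_pos zero_less_one)
    then have "ln (zeta1p \<epsilon>) + ln \<epsilon> = ln (\<epsilon> * zeta1p \<epsilon>)"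
      using that by (simp add: ln_mult_pos)
    moreover have "ln 1 \<le> ln (\<epsilon> * zeta1p \<epsilon>)"
      using b by (intro ln_mono) auto
    moreover have "ln (\<epsilon> * zeta1p \<epsilon>) \<le> ln (1 + \<epsilon>)"
      using b by (intro ln_mono) auto
    ultimately show ?thesis
      by simp
  qed
  then show "\<forall>\<^sub>F \<epsilon> in at_right 0. 0 \<le> ln (zeta1p \<epsilon>) + ln \<epsilon>"
    "\<forall>\<^sub>F \<epsilon> in at_right 0. ln (zeta1p \<epsilon>) + ln \<epsilon> \<le> ln (1 + \<epsilon>)"
    using eventually_at_right_less[of "0::real"] by (auto elim: eventually_mono)
  show "((\<lambda>\<epsilon>::real. ln (1 + \<epsilon>)) \<longlongrightarrow> 0) (at_right 0)"
    by real_asymp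
qed auto

text \<open>The logarithm of the Euler product, with the higher prime powers subtracted.\<close>

lemma sum_primes_powr_tendsto:
  assumes \<epsilon>: "\<epsilon> > 0"
  shows "(\<lambda>N. \<Sum>p\<in>primes_upto (real N). real p powr (-1-\<epsilon>)) \<longlonglongrightarrow>
    ln (zeta1p \<epsilon>) - prime_log_defect_sum \<epsilon>"
proof -
  have zpos: "zeta1p \<epsilon> > 0"
    using zeta1p_bounds(1)[OF \<epsilon>] \<epsilon> by (metis less_le_trans zero_less_mult_pos zero_less_one)
  have "(\<lambda>N. ln (zeta1p \<epsilon> * (\<Prod>p\<in>primes_upto (real N). 1 - real p powr (-1-\<epsilon>)))) \<longlonglongrightarrow> ln 1"
    by (intro tendsto_ln euler_product_zeta1p \<epsilon>) auto
  moreover have "ln (zeta1p \<epsilon> * (\<Prod>p\<in>primes_upto (real N). 1 - real p powr (-1-\<epsilon>))) =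
      ln (zeta1p \<epsilon>) + (\<Sum>p\<in>primes_upto (real N). ln (1 - real p powr (-1-\<epsilon>)))" for N
  proof -
    have "1 - real p powr (-1-\<epsilon>) > 0" if "p \<in> primes_upto (real N)" for p
      using prime_powr_bounds(3)[of p \<epsilon>] that \<epsilon> by (simp add: primes_upto_def)
    then show ?thesis
      using zpos by (subst ln_mult_pos) (auto intro!: prod_pos ln_prod[OF finite_primes_upto] simp: less_imp_neq)
  qed
  ultimately have 1: "(\<lambda>N. ln (zeta1p \<epsilon>) + (\<Sum>p\<in>primes_upto (real N). ln (1 - real p powr (-1-\<epsilon>)))) \<longlonglongrightarrow> 0"
    by simp
  have 2: "(\<lambda>N. \<Sum>p\<in>primes_upto (real N). prime_log_defect \<epsilon> p) \<longlonglongrightarrow> prime_log_defect_sum \<epsilon>"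
    unfolding prime_log_defect_sum_def
    by (rule sum_over_primes_tail(2)[of _ 2]) (use \<epsilon> prime_log_defect_bound in auto)
  have "(\<lambda>N. ln (zeta1p \<epsilon>) - (ln (zeta1p \<epsilon>) + (\<Sum>p\<in>primes_upto (real N). ln (1 - real p powr (-1-\<epsilon>)))) -
      (\<Sum>p\<in>primes_upto (real N). prime_log_defect \<epsilon> p)) \<longlonglongrightarrow>
      ln (zeta1p \<epsilon>) - 0 - prime_log_defect_sum \<epsilon>"
    by (intro tendsto_diff tendsto_const 1 2)
  then show ?thesis
    by (simp add: prime_log_defect_def sum_subtractf sum_negf)
qed

text \<open>On the primes with e^(m-1) < p \<le> e^m the weight p^(-\<epsilon>) is e^(-\<epsilon> m)
  up to a factor between 1 and e^\<epsilon>. The blocks thus turn a Dirichlet series over primes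
  into a power series in e^(-\<epsilon>), to which Abel's theorem applies.\<close>

definition exp_block_sum :: "nat \<Rightarrow> real" where
  "exp_block_sum m = (\<Sum>p\<in>primes_upto (exp (real m)) - primes_upto (exp (real m - 1)). 1 / real p)"

lemma primes_upto_exp_Suc:
  "primes_upto (exp (real (Suc N))) =
    primes_upto (exp (real N)) \<union> (primes_upto (exp (real (Suc N))) - primes_upto (exp (real (Suc N) - 1)))"
proof -
  have "primes_upto (exp (real N)) \<subseteq> primes_upto (exp (real (Suc N)))"
    unfolding primes_upto_def using order_trans[of _ "exp (real N)" "exp (real (Suc N))"] by auto
  moreover have "real (Suc N) - 1 = real N"
    by simp
  ultimately show ?thesis
    by (simp only: Un_Diff_cancel Un_absorb1)
qed

lemma primes_upto_less_two: "y < 2 \<Longrightarrow> primes_upto y = {}"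
  by (auto simp: primes_upto_def dest: prime_ge_2_nat)

lemma sum_exp_block_sum: "(\<Sum>m\<le>N. exp_block_sum m) = (\<Sum>p\<in>primes_upto (exp (real N)). 1 / real p)"
proof (induction N)
  case 0
  show ?case
    by (simp add: exp_block_sum_def primes_upto_less_two)
next
  case (Suc N)
  show ?case
    by (subst primes_upto_exp_Suc, subst sum.union_disjoint)
      (use Suc in \<open>auto simp: exp_block_sum_def\<close>)
qed

lemma exp_block_sum_sandwich:
  assumes \<epsilon>: "\<epsilon> > 0"
  defines "Q \<equiv> \<lambda>N. \<Sum>m\<le>N. exp_block_sum m * exp (-\<epsilon>) ^ m"
  defines "S \<equiv> \<lambda>N::nat. \<Sum>p\<in>primes_upto (exp (real N)). real p powr (-1-\<epsilon>)"
  shows "Q N \<le> S N \<and> S N \<le> exp \<epsilon> * Q N"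
proof (induction N)
  case 0
  show ?case
    by (simp add: Q_def S_def exp_block_sum_def primes_upto_less_two)
next
  case (Suc N)
  define D where "D = primes_upto (exp (real (Suc N))) - primes_upto (exp (real (Suc N) - 1))"
  have S: "S (Suc N) = S N + (\<Sum>p\<in>D. real p powr (-1-\<epsilon>))"
    unfolding S_def D_def by (subst primes_upto_exp_Suc, subst sum.union_disjoint) auto
  have Q: "Q (Suc N) = Q N + (\<Sum>p\<in>D. 1 / real p * exp (- \<epsilon> * real (Suc N)))"
    unfolding sum_distrib_right[symmetric]
    by (simp add: Q_def exp_block_sum_def D_def exp_of_nat_mult[symmetric] mult.commute
        del: of_nat_Suc power_Suc)
  have bounds: "1 / real p * exp (- \<epsilon> * real (Suc N)) \<le> real p powr (-1-\<epsilon>)"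
      "real p powr (-1-\<epsilon>) \<le> exp \<epsilon> * (1 / real p * exp (- \<epsilon> * real (Suc N)))" if "p \<in> D" for p
  proof -
    have p: "real p > 0" "real p \<le> exp (real (Suc N))" "real p > exp (real N)"
      using that by (auto simp: D_def primes_upto_def prime_gt_0_nat)
    have ln: "real N \<le> ln (real p)" "ln (real p) \<le> real (Suc N)"
      using ln_mono[OF less_imp_le[OF p(3)]] ln_mono[OF p(2,1)] by simp_all
    have eq: "real p powr (-1-\<epsilon>) = 1 / real p * exp (- \<epsilon> * ln (real p))"
      using p(1) powr_add[of "real p" "-1" "-\<epsilon>"]
      by (simp add: powr_minus_divide) (simp add: powr_def exp_minus field_simps)
    have "exp (- \<epsilon> * real (Suc N)) \<le> exp (- \<epsilon> * ln (real p))"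
      using ln \<epsilon> by (intro exp_le_cancel_iff[THEN iffD2]) (simp del: of_nat_Suc)
    then show "1 / real p * exp (- \<epsilon> * real (Suc N)) \<le> real p powr (-1-\<epsilon>)"
      unfolding eq by (intro mult_left_mono) auto
    have "exp (- \<epsilon> * ln (real p)) \<le> exp (- \<epsilon> * real N)"
      using ln \<epsilon> by (intro exp_le_cancel_iff[THEN iffD2]) simp
    also have "\<dots> = exp \<epsilon> * exp (- \<epsilon> * real (Suc N))"
      by (simp add: algebra_simps flip: exp_add)
    finally have "1 / real p * exp (- \<epsilon> * ln (real p)) \<le> 1 / real p * (exp \<epsilon> * exp (- \<epsilon> * real (Suc N)))"
      by (intro mult_left_mono) auto
    then show "real p powr (-1-\<epsilon>) \<le> exp \<epsilon> * (1 / real p * exp (- \<epsilon> * real (Suc N)))"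
      unfolding eq by (simp add: mult_ac)
  qed
  have "(\<Sum>p\<in>D. real p powr (-1-\<epsilon>)) \<le> exp \<epsilon> * (\<Sum>p\<in>D. 1 / real p * exp (- \<epsilon> * real (Suc N)))"
    unfolding sum_distrib_left by (intro sum_mono bounds)
  moreover have "(\<Sum>p\<in>D. 1 / real p * exp (- \<epsilon> * real (Suc N))) \<le> (\<Sum>p\<in>D. real p powr (-1-\<epsilon>))"
    by (intro sum_mono bounds)
  ultimately show ?case
    using Suc unfolding S Q distrib_left by linarith
qed

text \<open>The sum of \<open>1 / p\<close> over primes up to \<open>e\<^sup>N\<close> is compared with the harmonic number
  of \<open>N\<close>, which contributes Euler's constant. By Abel's limit theorem the limiting difference
  can be read off the generating functions at \<open>e\<^bsup>-\<epsilon>\<^esup>\<close>, which are governed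
  by \<open>\<zeta>(1 + \<epsilon>) \<sim> 1 / \<epsilon>\<close> and by \<open>- ln (1 - e\<^bsup>-\<epsilon>\<^esup>)\<close>.\<close>

lemma mertens_constant:
  assumes M: "\<And>y. y \<ge> 2 \<Longrightarrow> \<bar>(\<Sum>p\<in>primes_upto y. 1 / real p) - ln (ln y) - M\<bar> \<le> C / ln y"
  shows "M + prime_log_defect_sum 0 = euler_mascheroni"
proof -
  \<comment> \<open>At m = 0 the block is empty and 1/0 = 0, so the partial sums of \<open>d\<close>
    are prime sums up to e^N minus \<open>harm N\<close>. The former differ from ln N by M and the
    latter by Euler's constant in the limit, whence the value of \<open>l\<close>.\<close>
  define d where "d = (\<lambda>m. exp_block_sum m - 1 / real m)"
  define l where "l = M - euler_mascheroni"
  have dl: "d sums l"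
  proof -
    have "(\<lambda>N. (\<Sum>p\<in>primes_upto (exp (real N)). 1 / real p) - ln (real N) - M) \<longlonglongrightarrow> 0"
    proof (rule Lim_null_comparison)
      show "\<forall>\<^sub>F N in sequentially. norm ((\<Sum>p\<in>primes_upto (exp (real N)). 1 / real p) - ln (real N) - M)
          \<le> C / real N"
      proof (rule eventually_sequentiallyI[of 1])
        fix N :: nat assume "N \<ge> 1"
        then have "exp (real N) \<ge> 2"
          using exp_ge_add_one_self[of "real N"] by linarith
        from M[OF this] show "norm ((\<Sum>p\<in>primes_upto (exp (real N)). 1 / real p) - ln (real N) - M)
            \<le> C / real N"
          by simp
      qed
      show "(\<lambda>N. C / real N) \<longlonglongrightarrow> 0"
        by real_asymp
    qed
    from tendsto_diff[OF tendsto_add[OF this tendsto_const[of M]] euler_mascheroni_LIMSEQ]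
    have "(\<lambda>N. (\<Sum>p\<in>primes_upto (exp (real N)). 1 / real p) - harm N) \<longlonglongrightarrow> l"
      by (simp add: l_def)
    moreover have "(\<Sum>m\<le>N. d m) = (\<Sum>p\<in>primes_upto (exp (real N)). 1 / real p) - harm N" for N
    proof -
      have "(\<Sum>m\<le>N. 1 / real m) = harm N"
        unfolding harm_def by (rule sum.mono_neutral_cong_right) (auto simp: divide_inverse)
      then show ?thesis
        by (simp add: d_def sum_subtractf sum_exp_block_sum)
    qed
    ultimately show ?thesis
      by (simp add: sums_def_le)
  qed
  define Dz where "Dz = (\<lambda>\<epsilon>. \<Sum>m. d m * exp (-\<epsilon>) ^ m)"
  have "filterlim (\<lambda>\<epsilon>::real. exp (-\<epsilon>)) (at_left 1) (at_right 0)"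
    by real_asymp
  from filterlim_compose[OF abel_limit[OF dl] this]
  have Dz: "(Dz \<longlongrightarrow> l) (at_right 0)"
    by (simp add: Dz_def[abs_def])
  define G where "G = (\<lambda>\<epsilon>. ln (zeta1p \<epsilon>) - prime_log_defect_sum \<epsilon>)"
  have sandwich: "Dz \<epsilon> - ln (1 - exp (-\<epsilon>)) \<le> G \<epsilon> \<and> G \<epsilon> \<le> exp \<epsilon> * (Dz \<epsilon> - ln (1 - exp (-\<epsilon>)))"
    if \<epsilon>: "\<epsilon> > 0" for \<epsilon>
  proof -
    have z: "0 < exp (-\<epsilon>)" "exp (-\<epsilon>) < 1"
      using \<epsilon> by auto
    have "summable (\<lambda>m. d m * exp (-\<epsilon>) ^ m)"
      using powser_inside[of d 1 "exp (-\<epsilon>)"] dl z by (simp add: sums_iff)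
    then have 1: "(\<lambda>m. d m * exp (-\<epsilon>) ^ m) sums Dz \<epsilon>"
      by (simp add: Dz_def summable_sums)
    have "(\<lambda>m. - ((- (- exp (-\<epsilon>))) ^ m) / real m) sums ln (1 + - exp (-\<epsilon>))"
      by (rule ln_series') (use z in auto)
    then have 2: "(\<lambda>m. - (exp (-\<epsilon>) ^ m / real m)) sums ln (1 - exp (-\<epsilon>))"
      by simp
    have "(\<lambda>m. exp_block_sum m * exp (-\<epsilon>) ^ m) sums (Dz \<epsilon> - ln (1 - exp (-\<epsilon>)))"
      using sums_diff[OF 1 2] by (simp add: d_def algebra_simps)
    then have Q: "(\<lambda>N. \<Sum>m\<le>N. exp_block_sum m * exp (-\<epsilon>) ^ m) \<longlonglongrightarrow> Dz \<epsilon> - ln (1 - exp (-\<epsilon>))"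
      by (simp add: sums_def_le)
    \<comment> \<open>The limit over integer cutoffs is taken along the subsequence of the floors of
      e^N, which select the same primes as e^N.\<close>
    have "filterlim (\<lambda>N. nat \<lfloor>exp (real N)\<rfloor>) at_top sequentially"
      by real_asymp
    from filterlim_compose[OF sum_primes_powr_tendsto[OF \<epsilon>] this]
    have S: "(\<lambda>N. \<Sum>p\<in>primes_upto (exp (real N)). real p powr (-1-\<epsilon>)) \<longlonglongrightarrow> G \<epsilon>"
      by (simp only: G_def primes_upto_floor[OF exp_ge_zero, symmetric])
    show ?thesis
      using exp_block_sum_sandwich[OF \<epsilon>]
      by (intro conjI LIMSEQ_le[OF Q S] LIMSEQ_le[OF S tendsto_mult_left[OF Q]]) blast+
  qed
  have G: "((\<lambda>\<epsilon>. G \<epsilon> + ln (1 - exp (-\<epsilon>))) \<longlongrightarrow> - prime_log_defect_sum 0) (at_right 0)"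
  proof -
    have "((\<lambda>\<epsilon>::real. ln (1 - exp (-\<epsilon>)) - ln \<epsilon>) \<longlongrightarrow> 0) (at_right 0)"
      by real_asymp
    from tendsto_add[OF tendsto_diff[OF ln_zeta1p_tendsto prime_log_defect_sum_tendsto] this]
    show ?thesis
      by (simp add: G_def algebra_simps)
  qed
  have "l \<le> - prime_log_defect_sum 0"
  proof (rule tendsto_le[OF _ G Dz])
    show "\<forall>\<^sub>F \<epsilon> in at_right 0. Dz \<epsilon> \<le> G \<epsilon> + ln (1 - exp (-\<epsilon>))"
      using eventually_at_right_less[of "0::real"]
    proof eventually_elim
      case (elim \<epsilon>)
      show ?case
        using sandwich[OF elim] by linarith
    qed
  qed simp
  moreover have "- prime_log_defect_sum 0 \<le> l"
  proof (rule tendsto_le[OF _ _ G])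
    show "\<forall>\<^sub>F \<epsilon> in at_right 0. G \<epsilon> + ln (1 - exp (-\<epsilon>)) \<le>
        Dz \<epsilon> + ((exp \<epsilon> - 1) * Dz \<epsilon> - (exp \<epsilon> - 1) * ln (1 - exp (-\<epsilon>)))"
      using eventually_at_right_less[of "0::real"]
    proof eventually_elim
      case (elim \<epsilon>)
      show ?case
        using sandwich[OF elim] by (simp add: algebra_simps)
    qed
    have 1: "((\<lambda>\<epsilon>::real. (exp \<epsilon> - 1) * ln (1 - exp (-\<epsilon>))) \<longlongrightarrow> 0) (at_right 0)"
      by real_asymp
    have 2: "((\<lambda>\<epsilon>::real. exp \<epsilon> - 1) \<longlongrightarrow> 0) (at_right 0)"
      by real_asymp
    show "((\<lambda>\<epsilon>. Dz \<epsilon> + ((exp \<epsilon> - 1) * Dz \<epsilon> - (exp \<epsilon> - 1) * ln (1 - exp (-\<epsilon>)))) \<longlongrightarrow> l) (at_right 0)"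
      using tendsto_add[OF Dz tendsto_diff[OF tendsto_mult[OF 2 Dz] 1]] by simp
  qed simp
  ultimately show ?thesis
    by (simp add: l_def)
qed

text \<open>-ln(1 - 1/p) is 1/p plus a defect with convergent sum, so the constant is M plus that
  sum, already identified as Euler's constant.\<close>

theorem mertens_third:
  obtains C where "C \<ge> 0"
    "\<And>y. y \<ge> 2 \<Longrightarrow> \<bar>(\<Sum>p\<in>primes_upto y. - ln (1 - 1 / real p)) - ln (ln y) - euler_mascheroni\<bar> \<le> C / ln y"
proof -
  obtain M C where C: "C \<ge> 0"
    "\<And>y. y \<ge> 2 \<Longrightarrow> \<bar>(\<Sum>p\<in>primes_upto y. 1 / real p) - ln (ln y) - M\<bar> \<le> C / ln y"
    using mertens_second by blast
  have M: "M + prime_log_defect_sum 0 = euler_mascheroni"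
    by (rule mertens_constant[OF C(2)])
  show ?thesis
  proof
    show "C + 8 \<ge> 0"
      using C(1) by simp
    fix y :: real assume y: "y \<ge> 2"
    have "\<bar>(\<Sum>p\<in>primes_upto y. prime_log_defect 0 p) - prime_log_defect_sum 0\<bar> \<le> 4 * 2 / y"
      unfolding prime_log_defect_sum_def
      by (rule sum_over_primes_tail(3)) (use y prime_log_defect_bound in auto)
    also have "\<dots> \<le> 8 / ln y"
      using y ln_le_minus_one[of y] by (simp add: frac_le)
    finally have 1: "\<bar>(\<Sum>p\<in>primes_upto y. prime_log_defect 0 p) - prime_log_defect_sum 0\<bar> \<le> 8 / ln y" .
    have "(\<Sum>p\<in>primes_upto y. - ln (1 - 1 / real p)) =
        (\<Sum>p\<in>primes_upto y. 1 / real p) + (\<Sum>p\<in>primes_upto y. prime_log_defect 0 p)"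
      unfolding sum.distrib[symmetric]
      by (intro sum.cong refl) (simp add: prime_log_defect_def powr_minus_divide)
    then show "\<bar>(\<Sum>p\<in>primes_upto y. - ln (1 - 1 / real p)) - ln (ln y) - euler_mascheroni\<bar> \<le> (C + 8) / ln y"
      using 1 C(2)[OF y] M unfolding add_divide_distrib by linarith
  qed
qed

section \<open>The function F on the nonnegative reals\<close>

text \<open>At a prime this is the logarithm of the factor of F at r, because 1 + 1/(p - 1) is the
  reciprocal of 1 - 1/p.\<close>

definition log_factor :: "real \<Rightarrow> nat \<Rightarrow> real" where
  "log_factor r p = ln (1 + r / (real p - 1)) - r * ln (1 + 1 / (real p - 1))"

text \<open>With a = 1/(p - 1) both logarithms have the linear term r a, which cancels; the
  remainders are at most r a^2 and (r a)^2.\<close>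

lemma abs_log_factor_le:
  assumes "prime p" "0 \<le> r" "r \<le> A"
  shows "\<bar>log_factor r p\<bar> \<le> (A + 1)\<^sup>2 / (real p - 1)\<^sup>2"
proof -
  define a where "a = 1 / (real p - 1)"
  have a: "a \<ge> 0"
    using prime_gt_1_nat[OF assms(1)] by (simp add: a_def)
  have ra: "r * a \<ge> 0"
    using a assms by simp
  have r1: "r * (a - ln (1 + a)) \<le> r * a\<^sup>2" and r2: "r * ln (1 + a) \<le> r * a"
    using assms a by (intro mult_left_mono diff_ln_add_one_le_square ln_add_one_self_le_self; simp)+
  have "log_factor r p = ln (1 + r * a) - r * ln (1 + a)"
    by (simp add: log_factor_def a_def)
  moreover have "ln (1 + r * a) \<le> r * a" "r * a - ln (1 + r * a) \<le> (r * a)\<^sup>2"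
    using ra by (intro ln_add_one_self_le_self diff_ln_add_one_le_square; simp)+
  ultimately have "\<bar>log_factor r p\<bar> \<le> r * a\<^sup>2 + (r * a)\<^sup>2"
    using r1 r2 by (simp add: right_diff_distrib)
  also have "\<dots> = (r + r\<^sup>2) * a\<^sup>2"
    by (simp add: power_mult_distrib distrib_right)
  also have "\<dots> \<le> (A + 1)\<^sup>2 * a\<^sup>2"
  proof (intro mult_right_mono)
    have "r\<^sup>2 \<le> A\<^sup>2"
      using assms by (intro power_mono) auto
    then show "r + r\<^sup>2 \<le> (A + 1)\<^sup>2"
      using assms by (simp add: power2_eq_square algebra_simps)
  qed simp
  finally show ?thesis
    by (simp add: a_def power_divide)
qed

definition log_F :: "real \<Rightarrow> real" where
  "log_F r = (\<Sum>n. if prime n then log_factor r n else 0)"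

text \<open>For r \<ge> 0 every factor is positive, so the infinite product is the exponential of a
  convergent sum of real logarithms.\<close>

lemma F_of_real_eq:
  assumes "r \<ge> 0"
  shows "F (complex_of_real r) = complex_of_real (exp (log_F r))"
proof -
  define g where "g = (\<lambda>n. if prime n then log_factor r n else 0)"
  have g: "summable g"
    unfolding g_def by (rule sum_over_primes_tail(1)[of _ "(r + 1)\<^sup>2"]) (use assms in \<open>auto intro: abs_log_factor_le\<close>)
  have "(if prime p then (1 + complex_of_real r / (of_nat p - 1)) * (1 - 1 / of_nat p) powr complex_of_real r else 1)
      = exp (complex_of_real (g p))" for p :: nat
  proof (cases "prime p")
    case True
    then have p: "real p > 1"
      using prime_gt_1_nat by simp
    have "1 + 1 / (real p - 1) = 1 / (1 - 1 / real p)"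
      using p by (simp add: field_simps)
    then have ln: "ln (1 + 1 / (real p - 1)) = - ln (1 - 1 / real p)"
      using p by (simp add: ln_div)
    have "1 + r / (real p - 1) > 0"
      using p assms by (intro add_pos_nonneg) auto
    then have "exp (g p) = (1 + r / (real p - 1)) * (1 - 1 / real p) powr r"
      using True p by (simp add: g_def log_factor_def ln exp_add powr_def)
    moreover have "(1 - 1 / complex_of_nat p) powr complex_of_real r = complex_of_real ((1 - 1 / real p) powr r)"
      using p powr_of_real[of "1 - 1 / real p" r] by simp
    moreover have "exp (complex_of_real (g p)) = complex_of_real (exp (g p))"
      by (rule exp_of_real)
    ultimately show ?thesis
      using True by simp
  qed (simp add: g_def)
  then have "F (complex_of_real r) = prodinf (\<lambda>p. exp (complex_of_real (g p)))"
    unfolding F_def by (intro prodinf_cong)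
  also have "\<dots> = exp (suminf (\<lambda>p. complex_of_real (g p)))"
    using g by (intro prodinf_exp summable_of_real)
  also have "suminf (\<lambda>p. complex_of_real (g p)) = complex_of_real (log_F r)"
    using suminf_of_real[OF g, where 'a = complex] by (simp add: log_F_def g_def)
  finally show ?thesis
    by (simp add: exp_of_real)
qed

lemma log_F_approx:
  assumes "0 \<le> r" "r \<le> A" "y \<ge> 2"
  shows "\<bar>(\<Sum>p\<in>primes_upto y. log_factor r p) - log_F r\<bar> \<le> 4 * (A + 1)\<^sup>2 / y"
  unfolding log_F_def
  by (rule sum_over_primes_tail(3)) (use assms in \<open>auto intro: abs_log_factor_le\<close>)

lemma abs_log_F_le:
  assumes "0 \<le> r" "r \<le> A"
  shows "\<bar>log_F r\<bar> \<le> 3 * (A + 1)\<^sup>2"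
proof -
  \<comment> \<open>At y = 2 the partial sum is the single term at 2, bounded by (A + 1)^2, and the
    tail bound is 4/2 = 2 times this; together they give the constant 3.\<close>
  have "primes_upto 2 = {2}"
    by (auto simp: primes_upto_def dest: prime_ge_2_nat)
  then have "\<bar>log_factor r 2 - log_F r\<bar> \<le> 2 * (A + 1)\<^sup>2"
    using log_F_approx[OF assms, of 2] by simp
  moreover have "\<bar>log_factor r 2\<bar> \<le> (A + 1)\<^sup>2"
    using abs_log_factor_le[OF two_is_prime_nat assms] by simp
  ultimately show ?thesis
    by linarith
qed

lemma sum_inverse_squares_primes_bounded:
  obtains Q where "\<And>y. (\<Sum>p\<in>primes_upto y. (1 / (real p - 1))\<^sup>2) \<le> Q"
proof
  fix y :: real
  let ?f = "\<lambda>p. (1 / (real p - 1))\<^sup>2"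
  have s: "summable (\<lambda>n. if prime n then ?f n else 0)"
    by (rule sum_over_primes_tail(1)[of _ 1]) (auto simp: power_divide)
  have "(\<Sum>p\<in>primes_upto y. ?f p) = (\<Sum>p\<in>primes_upto y. if prime p then ?f p else 0)"
    by (intro sum.cong) (auto simp: primes_upto_def)
  also have "\<dots> \<le> (\<Sum>n. if prime n then ?f n else 0)"
    by (intro sum_le_suminf s) auto
  finally show "(\<Sum>p\<in>primes_upto y. ?f p) \<le> (\<Sum>n. if prime n then ?f n else 0)" .
qed

section \<open>Rankin's trick and the asymptotic formula\<close>

lemma exp_minus_one_le: "exp s - 1 \<le> s * exp s" for s :: real
proof -
  have "(1 - s) * exp s \<le> exp (- s) * exp s"
    using exp_ge_add_one_self[of "- s"] by (intro mult_right_mono) auto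
  then show ?thesis
    by (simp add: algebra_simps flip: exp_add)
qed

text \<open>The exponent shift \<alpha>/ln y keeps p^(\<alpha>/ln y) = e^s with s \<le> \<alpha> for
  all p \<le> y. By e^s \<le> 1 + s e^\<alpha> the sum over primes splits into the sum of 1/p, which
  gives ln ln y + O(1), and the sum of ln p/p, which gives O(\<alpha> e^\<alpha>). The constant is
  uniform in r and \<alpha>.\<close>

lemma rankin_prod_bound:
  obtains K where "K \<ge> 0"
    "\<And>y \<alpha> r. y \<ge> 3 \<Longrightarrow> 0 \<le> \<alpha> \<Longrightarrow> 0 \<le> r \<Longrightarrow>
      (\<Prod>p\<in>primes_upto y. 1 + (1 + r) * real p powr (\<alpha> / ln y - 1)) \<le>
      exp ((1 + r) * (ln (ln y) + K * (1 + \<alpha> * exp \<alpha>)))"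
proof -
  obtain K1 where K1: "K1 \<ge> 0"
    "\<And>n. n \<ge> 1 \<Longrightarrow> \<bar>(\<Sum>p\<in>primes_upto (real n). ln (real p) / real p) - ln (real n)\<bar> \<le> K1"
    using mertens_first by blast
  obtain M C where C: "C \<ge> 0"
    "\<And>y. y \<ge> 2 \<Longrightarrow> \<bar>(\<Sum>p\<in>primes_upto y. 1 / real p) - ln (ln y) - M\<bar> \<le> C / ln y"
    using mertens_second by blast
  \<comment> \<open>The first entry covers the constants of Mertens' second theorem; the second
    absorbs ln y + K1 into (1 + K1) ln y, using ln y \<ge> 1.\<close>
  define K where "K = max (\<bar>M\<bar> + C) (1 + K1)"
  show ?thesis
  proof
    show "K \<ge> 0"
      using K1 by (simp add: K_def)
    fix y \<alpha> r :: real
    assume y: "y \<ge> 3" and \<alpha>: "0 \<le> \<alpha>" and r: "0 \<le> r"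
    have lny: "ln y \<ge> 1"
      using y exp_le by (subst ln_ge_iff) auto
    define P where "P = primes_upto y"
    define n where "n = nat \<lfloor>y\<rfloor>"
    have n: "n \<ge> 1" "real n \<le> y"
      using y unfolding n_def by linarith+
    have "(\<Sum>p\<in>P. ln (real p) / real p) \<le> ln (real n) + K1"
      using K1(2)[OF n(1)] primes_upto_floor[of y] y by (simp add: P_def n_def)
    also have "\<dots> \<le> ln y + K1"
      using n by (intro add_mono ln_mono) auto
    finally have S1: "(\<Sum>p\<in>P. ln (real p) / real p) \<le> ln y + K1" .
    have "C / ln y \<le> C / 1"
      using lny C by (intro divide_left_mono) auto
    with C(2)[of y] y have S2: "(\<Sum>p\<in>P. 1 / real p) \<le> ln (ln y) + K"
      unfolding P_def K_def by linarith
    have term_le: "real p powr (\<alpha> / ln y - 1) \<le> 1 / real p + \<alpha> * exp \<alpha> / ln y * (ln (real p) / real p)"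
      if "p \<in> P" for p
    proof -
      have p: "real p \<ge> 2" "real p \<le> y"
        using that by (auto simp: P_def primes_upto_def dest: prime_ge_2_nat)
      define s where "s = \<alpha> / ln y * ln (real p)"
      have s: "s \<ge> 0" "s \<le> \<alpha>"
      proof -
        show "s \<ge> 0"
          using p \<alpha> lny by (simp add: s_def)
        have "s \<le> \<alpha> / ln y * ln y"
          unfolding s_def using p \<alpha> lny by (intro mult_left_mono ln_mono) auto
        then show "s \<le> \<alpha>"
          using lny by simp
      qed
      have "exp s \<le> 1 + s * exp s"
        using exp_minus_one_le[of s] by simp
      also have "s * exp s \<le> s * exp \<alpha>"
        using s by (intro mult_left_mono) auto
      finally have "exp s \<le> 1 + s * exp \<alpha>"
        by simp
      moreover have "real p powr (\<alpha> / ln y - 1) = exp s / real p"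
        using p by (subst powr_diff) (auto simp: s_def powr_def)
      ultimately have "real p powr (\<alpha> / ln y - 1) \<le> (1 + s * exp \<alpha>) / real p"
        using p by (simp add: divide_right_mono)
      also have "\<dots> = 1 / real p + \<alpha> * exp \<alpha> / ln y * (ln (real p) / real p)"
        by (simp add: s_def add_divide_distrib mult_ac)
      finally show ?thesis .
    qed
    have "(\<Sum>p\<in>P. real p powr (\<alpha> / ln y - 1)) \<le>
        (\<Sum>p\<in>P. 1 / real p + \<alpha> * exp \<alpha> / ln y * (ln (real p) / real p))"
      by (intro sum_mono term_le)
    also have "\<dots> = (\<Sum>p\<in>P. 1 / real p) + \<alpha> * exp \<alpha> / ln y * (\<Sum>p\<in>P. ln (real p) / real p)"
      by (simp add: sum.distrib sum_distrib_left)
    also have "\<dots> \<le> (ln (ln y) + K) + \<alpha> * exp \<alpha> / ln y * (ln y * K)"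
    proof (intro add_mono S2 mult_left_mono order_trans[OF S1])
      have "ln y + K1 \<le> ln y * (1 + K1)"
        using K1(1) mult_right_mono[OF lny K1(1)] by (simp add: algebra_simps)
      also have "\<dots> \<le> ln y * K"
        using lny by (intro mult_left_mono) (auto simp: K_def)
      finally show "ln y + K1 \<le> ln y * K" .
    qed (use \<alpha> lny in auto)
    also have "\<dots> = ln (ln y) + K * (1 + \<alpha> * exp \<alpha>)"
      using lny by (simp add: field_simps)
    finally have sum: "(\<Sum>p\<in>P. real p powr (\<alpha> / ln y - 1)) \<le> ln (ln y) + K * (1 + \<alpha> * exp \<alpha>)" .
    have "(\<Prod>p\<in>P. 1 + (1 + r) * real p powr (\<alpha> / ln y - 1)) \<le>
        exp (\<Sum>p\<in>P. (1 + r) * real p powr (\<alpha> / ln y - 1))"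
      using r by (intro prod_le_exp_sum) auto
    also have "\<dots> \<le> exp ((1 + r) * (ln (ln y) + K * (1 + \<alpha> * exp \<alpha>)))"
      using sum r by (simp flip: sum_distrib_left)
    finally show "(\<Prod>p\<in>primes_upto y. 1 + (1 + r) * real p powr (\<alpha> / ln y - 1)) \<le>
      exp ((1 + r) * (ln (ln y) + K * (1 + \<alpha> * exp \<alpha>)))"
      by (simp add: P_def)
  qed
qed

text \<open>A weak Stirling bound, whose induction step is e \<le> (1 + 1/k)^(k+1). Its factor
  e^(-k) cancels the e^(rL) of Rankin's bound; the maximum keeps the right side nonzero at k =
  0.\<close>

lemma fact_le_power_exp: "fact k \<le> exp 1 * real (max 1 k) * (real k ^ k * exp (- real k))"
proof (cases "k = 0")
  case False
  then have "k \<ge> 1"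
    by simp
  then show ?thesis
  proof (induction k rule: dec_induct)
    case base
    then show ?case
      by (simp flip: exp_add)
  next
    case (step k)
    have k: "real k > 0"
      using step by simp
    have "ln (real k / real (Suc k)) \<le> real k / real (Suc k) - 1"
      using k by (intro ln_le_minus_one) auto
    then have "ln (real k) - ln (real (Suc k)) \<le> - 1 / real (Suc k)"
      using k by (simp add: ln_div field_simps)
    then have "real (Suc k) * (ln (real k) - ln (real (Suc k))) \<le> real (Suc k) * (- 1 / real (Suc k))"
      by (intro mult_left_mono) auto
    then have "1 + real (Suc k) * ln (real k) \<le> real (Suc k) * ln (real (Suc k))"
      by (simp add: algebra_simps)
    then have "exp (1 + real (Suc k) * ln (real k)) \<le> exp (real (Suc k) * ln (real (Suc k)))"
      by simp
    then have *: "exp 1 * real k ^ Suc k \<le> real (Suc k) ^ Suc k"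
      using k unfolding exp_add exp_of_nat_mult by (simp del: of_nat_Suc power_Suc)
    have "fact (Suc k) \<le> real (Suc k) * (exp 1 * real k * (real k ^ k * exp (- real k)))"
      using step by (simp del: of_nat_Suc add: max_def mult_left_mono)
    also have "\<dots> = exp 1 * real (Suc k) * ((exp 1 * real k ^ Suc k) * exp (- real (Suc k)))"
      by (simp add: mult_ac flip: exp_add)
    also have "\<dots> \<le> exp 1 * real (Suc k) * (real (Suc k) ^ Suc k * exp (- real (Suc k)))"
      using * by (intro mult_left_mono mult_right_mono) auto
    finally show ?case
      by (simp del: of_nat_Suc fact_Suc power_Suc add: max_def)
  qed
qed simp

text \<open>The predicted value of the count, with F(r) written as
  \<open>exp (log_F r)\<close>.\<close>

definition main_term :: "real \<Rightarrow> real \<Rightarrow> nat \<Rightarrow> real" where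
  "main_term x y k = exp (log_F (real k / ln (ln y)) + euler_mascheroni * (real k / ln (ln y) - 1)) *
     (x * ln (ln y) ^ k / (fact k * ln y))"

lemma ln_ge_one_if_ge_three: "y \<ge> 3 \<Longrightarrow> ln y \<ge> (1::real)"
  using exp_le by (subst ln_ge_iff) auto

text \<open>Since 3 > e, the hypothesis y \<ge> 3 keeps ln ln y away from 0, which the range of
  bounded ln ln y needs.\<close>

lemma ln_ln_pos_if_ge_three: "y \<ge> 3 \<Longrightarrow> ln (ln (y::real)) \<ge> ln (ln 3)" "ln (ln (3::real)) > 0"
proof -
  have "exp 1 < (3::real)"
    using e_less_272 by simp
  then have "ln (exp 1) < ln (3::real)"
    by (subst ln_less_cancel_iff) auto
  then have 1: "(1::real) < ln 3"
    by simp
  then show "ln (ln (3::real)) > 0"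
    by simp
  show "ln (ln y) \<ge> ln (ln 3)" if "y \<ge> 3"
    using that 1 by (intro ln_mono) auto
qed

lemma abs_exp_minus_one_le: "\<bar>exp t - 1\<bar> \<le> \<bar>t\<bar> * exp \<bar>t\<bar>" for t :: real
proof (cases "t \<ge> 0")
  case True
  then show ?thesis
    using exp_minus_one_le[of t] by simp
next
  case False
  have "1 - exp t \<le> - t"
    using exp_ge_add_one_self[of t] by linarith
  also have "\<dots> \<le> (- t) * exp (- t)"
    using False mult_left_mono[of 1 "exp (- t)" "- t"] by simp
  finally show ?thesis
    using False by simp
qed

text \<open>F(r) e^(\<gamma>(r-1)) therefore lies between positive constants depending only on A:
  the upper one bounds errors, the lower one turns absolute errors into relative ones.\<close>

lemma main_term_exponent_le:
  assumes "0 \<le> r" "r \<le> A"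
  shows "\<bar>log_F r + euler_mascheroni * (r - 1)\<bar> \<le> 3 * (A + 1)\<^sup>2 + (A + 1)"
proof -
  have "\<bar>euler_mascheroni * (r - 1)\<bar> \<le> 1 * (A + 1 :: real)"
    unfolding abs_mult using assms euler_mascheroni_pos euler_mascheroni_less_13_over_22
    by (intro mult_mono) auto
  then show ?thesis
    using abs_log_F_le[OF assms] by (intro order.trans[OF abs_triangle_ineq]) simp
qed

text \<open>Two errors occur: replacing the coefficient by L^k/k! G(r) costs O(k/L^2), and replacing
  the finite products over primes by their limits costs O(1/ln y), hence O(1/L^2). The second is not
  proportional to k, which is what forces \<open>max 1 k\<close>.\<close>

lemma sieve_main_term:
  assumes A: "A \<ge> 1"
  obtains C where "C \<ge> 0"
    "\<And>y k. y \<ge> 3 \<Longrightarrow> real k / ln (ln y) \<le> A \<Longrightarrow>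
      \<bar>(\<Prod>p\<in>primes_upto y. 1 - 1 / real p) * coeff (\<Prod>p\<in>primes_upto y. [:1, 1 / (real p - 1):]) k -
        main_term 1 y k\<bar>
      \<le> C * (real (max 1 k) / (ln (ln y))\<^sup>2) * (ln (ln y) ^ k / (fact k * ln y))"
proof -
  obtain C3 where C3: "C3 \<ge> 0"
    "\<And>y. y \<ge> 2 \<Longrightarrow> \<bar>(\<Sum>p\<in>primes_upto y. - ln (1 - 1 / real p)) - ln (ln y) - euler_mascheroni\<bar> \<le> C3 / ln y"
    using mertens_third by blast
  obtain Q where Q: "\<And>y. (\<Sum>p\<in>primes_upto y. (1 / (real p - 1))\<^sup>2) \<le> Q"
    using sum_inverse_squares_primes_bounded by blast
  define D where "D = 1 + C3"
  define C4 where "C4 = exp (exp (4 * A) * Q + 2 * A * D)"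
  define C5 where "C5 = 4 * (A + 1)\<^sup>2 + (A + 1) * C3"
  define C6 where "C6 = exp (3 * (A + 1)\<^sup>2 + (A + 1))"
  define C where "C = exp D * C4 + C6 * (2 * C5 * exp C5)"
  have C5: "C5 \<ge> 0"
    using A C3(1) by (simp add: C5_def)
  show ?thesis
  proof
    show "C \<ge> 0"
      using C5 by (simp add: C_def C4_def C6_def)
    fix y :: real and k :: nat
    define L where "L = ln (ln y)"
    define r where "r = real k / L"
    define P where "P = primes_upto y"
    define a where "a = (\<lambda>p::nat. 1 / (real p - 1))"
    define B where "B = (\<Sum>p\<in>P. ln (1 + a p))"
    define W where "W = (\<Prod>p\<in>P. 1 - 1 / real p)"
    define c where "c = coeff (\<Prod>p\<in>P. [:1, a p:]) k"
    define T where "T = L ^ k / (fact k * ln y)"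
    define \<Lambda> where "\<Lambda> = (\<Sum>p\<in>P. log_factor r p)"
    define e where "e = log_F r + euler_mascheroni * (r - 1)"
    assume y: "y \<ge> 3" and "real k / ln (ln y) \<le> A"
    then have rA: "r \<le> A"
      by (simp add: r_def L_def)
    have lny: "ln y \<ge> 1"
      using y by (rule ln_ge_one_if_ge_three)
    have L: "L > 0"
      using ln_ln_pos_if_ge_three(1)[OF y] ln_ln_pos_if_ge_three(2) unfolding L_def by linarith
    have r0: "r \<ge> 0"
      using L by (simp add: r_def)
    have expL: "exp L = ln y"
      using lny by (simp add: L_def)
    have T0: "T \<ge> 0"
      using L lny by (simp add: T_def)
    have p1: "real p > 1" "1 - 1 / real p > 0" "0 \<le> a p" "a p \<le> 1"
        "ln (1 + a p) = - ln (1 - 1 / real p)" if "p \<in> P" for p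
    proof -
      have p: "real p \<ge> 2"
        using that by (auto simp: P_def primes_upto_def dest: prime_ge_2_nat)
      then show "real p > 1" "1 - 1 / real p > 0" "0 \<le> a p" "a p \<le> 1"
        by (auto simp: a_def)
      have "1 + a p = 1 / (1 - 1 / real p)"
        using p by (simp add: a_def field_simps)
      then show "ln (1 + a p) = - ln (1 - 1 / real p)"
        using p by (simp add: ln_div)
    qed
    have "B = (\<Sum>p\<in>P. - ln (1 - 1 / real p))"
      unfolding B_def using p1(5) by (intro sum.cong) auto
    then have B: "\<bar>B - L - euler_mascheroni\<bar> \<le> C3 / ln y"
      using C3(2)[of y] y by (simp add: P_def L_def)
    have "C3 / ln y \<le> C3 / 1"
      using lny C3 by (intro divide_left_mono) auto
    then have BD: "\<bar>B - L\<bar> \<le> D"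
      using B euler_mascheroni_pos euler_mascheroni_less_13_over_22 unfolding D_def by linarith
    have "W = exp (\<Sum>p\<in>P. ln (1 - 1 / real p))"
      unfolding W_def using p1(2) by (subst exp_sum) (auto simp: P_def intro!: prod.cong)
    also have "(\<Sum>p\<in>P. ln (1 - 1 / real p)) = - B"
      unfolding B_def sum_negf[symmetric] using p1(5) by (intro sum.cong) auto
    finally have W: "W = exp (- B)" .
    have "(\<Prod>p\<in>P. 1 + a p * r) = exp (\<Sum>p\<in>P. ln (1 + a p * r))"
    proof (subst exp_sum)
      show "(\<Prod>p\<in>P. 1 + a p * r) = (\<Prod>p\<in>P. exp (ln (1 + a p * r)))"
      proof (intro prod.cong refl)
        fix p assume "p \<in> P"
        then have "1 + a p * r > 0"
          using p1(3)[of p] r0 by (intro add_pos_nonneg) auto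
        then show "1 + a p * r = exp (ln (1 + a p * r))"
          by simp
      qed
    qed (simp add: P_def)
    also have "(\<Sum>p\<in>P. ln (1 + a p * r)) = \<Lambda> + r * B"
      unfolding \<Lambda>_def B_def sum_distrib_left sum.distrib[symmetric]
      by (intro sum.cong) (auto simp: log_factor_def a_def)
    finally have prod_r: "(\<Prod>p\<in>P. 1 + a p * r) = exp (\<Lambda> + r * B)" .
    define G where "G = exp (\<Lambda> + r * B) * exp (- L * r)"
    have "\<bar>c - L ^ k / fact k * ((\<Prod>p\<in>P. 1 + a p * r) * exp (- L * r))\<bar> \<le>
        L ^ k / fact k * (C4 * (real k / L\<^sup>2))"
      unfolding c_def r_def C4_def
    proof (rule coeff_prod_linear_approx)
      show "(\<Sum>p\<in>P. (a p)\<^sup>2) \<le> Q"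
        using Q[of y] by (simp add: P_def a_def)
      show "\<bar>(\<Sum>p\<in>P. ln (1 + a p)) - L\<bar> \<le> D"
        using BD by (simp add: B_def)
      show "real k / L \<le> A"
        using rA by (simp add: r_def)
    qed (use p1(3,4) L A in \<open>auto simp: P_def\<close>)
    then have "\<bar>c - L ^ k / fact k * G\<bar> \<le> L ^ k / fact k * (C4 * (real k / L\<^sup>2))"
      by (simp only: G_def prod_r)
    then have "W * \<bar>c - L ^ k / fact k * G\<bar> \<le> (exp D * (1 / ln y)) * (L ^ k / fact k * (C4 * (real k / L\<^sup>2)))"
    proof (intro mult_mono)
      have "W = exp (- (B - L)) * (1 / ln y)"
        by (simp add: W exp_diff exp_minus field_simps flip: expL)
      also have "\<dots> \<le> exp D * (1 / ln y)"
        using BD lny by (intro mult_right_mono) auto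
      finally show "W \<le> exp D * (1 / ln y)" .
    qed (use lny in auto)
    also have "\<dots> = exp D * C4 * (real k / L\<^sup>2) * T"
      by (simp add: T_def mult_ac)
    also have "\<dots> \<le> exp D * C4 * (real (max 1 k) / L\<^sup>2) * T"
      using T0 by (intro mult_right_mono mult_left_mono divide_right_mono) (auto simp: C4_def)
    finally have 1: "W * \<bar>c - L ^ k / fact k * G\<bar> \<le> exp D * C4 * (real (max 1 k) / L\<^sup>2) * T" .
    \<comment> \<open>\<theta> is the deviation in the exponent: the exponent of W G is Lambda + rB
      - rL - B, which equals e + \<theta> - L.\<close>
    define \<theta> where "\<theta> = \<Lambda> - log_F r + (r - 1) * (B - L - euler_mascheroni)"
    have \<theta>: "\<bar>\<theta>\<bar> \<le> C5 / ln y"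
    proof -
      have "\<bar>\<Lambda> - log_F r\<bar> \<le> 4 * (A + 1)\<^sup>2 / y"
        using log_F_approx[OF r0 rA, of y] y by (simp add: \<Lambda>_def P_def)
      also have "\<dots> \<le> 4 * (A + 1)\<^sup>2 / ln y"
        using y lny ln_le_minus_one[of y] by (intro divide_left_mono) auto
      finally have "\<bar>\<Lambda> - log_F r\<bar> \<le> 4 * (A + 1)\<^sup>2 / ln y" .
      moreover have "\<bar>(r - 1) * (B - L - euler_mascheroni)\<bar> \<le> (A + 1) * (C3 / ln y)"
        unfolding abs_mult using B r0 rA by (intro mult_mono) auto
      ultimately show ?thesis
        unfolding \<theta>_def C5_def add_divide_distrib by simp
    qed
    have "C5 / ln y \<le> C5"
      using C5 lny divide_left_mono[of 1 "ln y" C5] by simp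
    with \<theta> have \<theta>': "\<bar>\<theta>\<bar> \<le> C5"
      by linarith
    \<comment> \<open>From ln y = e^L \<ge> 1 + L + L^2/2.\<close>
    have "L\<^sup>2 \<le> 2 * ln y"
      using exp_lower_Taylor_quadratic[of L] L by (simp add: expL)
    then have lnL: "1 / ln y \<le> 2 / L\<^sup>2"
      using L lny by (simp add: field_simps)
    have "W * (L ^ k / fact k * G) = exp e * exp \<theta> * T"
    proof -
      have "W * G = exp (e + \<theta> - L)"
        by (simp add: W G_def e_def \<theta>_def algebra_simps flip: exp_add)
      also have "\<dots> = exp e * exp \<theta> * (1 / ln y)"
        by (simp add: exp_diff exp_add expL)
      finally have WG: "W * G = exp e * exp \<theta> * (1 / ln y)" .
      have "W * (L ^ k / fact k * G) = L ^ k / fact k * (W * G)"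
        by simp
      then show ?thesis
        unfolding WG by (simp add: T_def)
    qed
    moreover have "main_term 1 y k = exp e * T"
      by (simp add: main_term_def e_def T_def r_def L_def)
    ultimately have "\<bar>W * (L ^ k / fact k * G) - main_term 1 y k\<bar> = \<bar>exp e * T * (exp \<theta> - 1)\<bar>"
      by (simp add: right_diff_distrib mult_ac)
    also have "\<dots> = exp e * T * \<bar>exp \<theta> - 1\<bar>"
      using T0 by (simp add: abs_mult)
    also have "\<dots> \<le> C6 * T * (C5 * (2 / L\<^sup>2) * exp C5)"
    proof (intro mult_mono)
      show "exp e \<le> C6"
        using main_term_exponent_le[OF r0 rA] by (simp add: e_def C6_def)
      have "\<bar>exp \<theta> - 1\<bar> \<le> \<bar>\<theta>\<bar> * exp \<bar>\<theta>\<bar>"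
        by (rule abs_exp_minus_one_le)
      also have "\<dots> \<le> (C5 * (1 / ln y)) * exp C5"
        using \<theta> \<theta>' C5 lny by (intro mult_mono) auto
      also have "\<dots> \<le> C5 * (2 / L\<^sup>2) * exp C5"
        using lnL C5 by (intro mult_right_mono mult_left_mono) auto
      finally show "\<bar>exp \<theta> - 1\<bar> \<le> C5 * (2 / L\<^sup>2) * exp C5" .
    qed (use T0 in \<open>auto simp: C6_def\<close>)
    also have "\<dots> = C6 * (2 * C5 * exp C5) * (1 / L\<^sup>2) * T"
      by simp
    also have "\<dots> \<le> C6 * (2 * C5 * exp C5) * (real (max 1 k) / L\<^sup>2) * T"
      using T0 C5 by (intro mult_right_mono mult_left_mono divide_right_mono) (auto simp: C6_def)
    finally have 2: "\<bar>W * (L ^ k / fact k * G) - main_term 1 y k\<bar> \<le>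
        C6 * (2 * C5 * exp C5) * (real (max 1 k) / L\<^sup>2) * T" .
    have "W \<ge> 0"
      by (simp add: W)
    have "\<bar>W * c - main_term 1 y k\<bar> \<le> \<bar>W * (c - L ^ k / fact k * G)\<bar> + \<bar>W * (L ^ k / fact k * G) - main_term 1 y k\<bar>"
      unfolding right_diff_distrib
      using abs_triangle_ineq[of "W * c - W * (L ^ k / fact k * G)" "W * (L ^ k / fact k * G) - main_term 1 y k"]
      by simp
    also have "\<dots> \<le> C * (real (max 1 k) / L\<^sup>2) * T"
      using 1 2 \<open>W \<ge> 0\<close> unfolding C_def distrib_right abs_mult by simp
    finally show "\<bar>(\<Prod>p\<in>primes_upto y. 1 - 1 / real p) * coeff (\<Prod>p\<in>primes_upto y. [:1, 1 / (real p - 1):]) k -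
        main_term 1 y k\<bar>
      \<le> C * (real (max 1 k) / (ln (ln y))\<^sup>2) * (ln (ln y) ^ k / (fact k * ln y))"
      by (simp add: W_def c_def P_def a_def T_def L_def)
  qed
qed

text \<open>In units of L the exponent is at most -10 from the saving, +1 from (1 + r) L apart from
  its part rL = k, and +1 from the term containing A. This leaves k - 8L; Stirling cancels k, and
  e^(-8L) beats 1/(L^2 ln y), as L^2 ln y \<le> e^(3L).\<close>

lemma sieve_error_term:
  assumes A: "A \<ge> 1"
  obtains L0 where "L0 \<ge> exp 1"
    "\<And>x y k. x \<ge> 1 \<Longrightarrow> y \<ge> 3 \<Longrightarrow> real k / ln (ln y) \<le> A \<Longrightarrow> ln (ln y) \<ge> L0 \<Longrightarrow>
      ln x / ln y \<ge> 20 * (ln (ln y) / ln (ln (ln y))) \<Longrightarrow>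
      \<bar>real (N_count k x y) - x * ((\<Prod>p\<in>primes_upto y. 1 - 1 / real p) *
        coeff (\<Prod>p\<in>primes_upto y. [:1, 1 / (real p - 1):]) k)\<bar>
      \<le> exp 1 * (real (max 1 k) / (ln (ln y))\<^sup>2) * (x * ln (ln y) ^ k / (fact k * ln y))"
proof -
  obtain K where K: "K \<ge> 0"
    "\<And>y \<alpha> r. y \<ge> 3 \<Longrightarrow> 0 \<le> \<alpha> \<Longrightarrow> 0 \<le> r \<Longrightarrow>
      (\<Prod>p\<in>primes_upto y. 1 + (1 + r) * real p powr (\<alpha> / ln y - 1)) \<le>
      exp ((1 + r) * (ln (ln y) + K * (1 + \<alpha> * exp \<alpha>)))"
    using rankin_prod_bound by blast
  \<comment> \<open>Only this threshold depends on A. As exp(ln L/2) is the square root of L, the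
    left side is of smaller order than L.\<close>
  have "eventually (\<lambda>L::real. (1 + A) * (K * (1 + ln L / 2 * exp (ln L / 2))) \<le> L) at_top"
  proof -
    have "((\<lambda>L::real. (1 + ln L / 2 * exp (ln L / 2)) / L) \<longlongrightarrow> 0) at_top"
      by real_asymp
    then have "((\<lambda>L::real. (1 + A) * K * ((1 + ln L / 2 * exp (ln L / 2)) / L)) \<longlongrightarrow> 0) at_top"
      by (rule tendsto_mult_right_zero)
    then have "eventually (\<lambda>L::real. (1 + A) * K * ((1 + ln L / 2 * exp (ln L / 2)) / L) < 1) at_top"
      by (rule order_tendstoD) simp
    then show ?thesis
      using eventually_gt_at_top[of 0] by eventually_elim (simp add: field_simps)
  qed
  then obtain L1 where L1: "\<And>L. L \<ge> L1 \<Longrightarrow> (1 + A) * (K * (1 + ln L / 2 * exp (ln L / 2))) \<le> L"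
    by (auto simp: eventually_at_top_linorder)
  show ?thesis
  proof
    show "max L1 (exp 1) \<ge> exp 1"
      by simp
    fix x y :: real and k :: nat
    define L where "L = ln (ln y)"
    define r where "r = real k / L"
    \<comment> \<open>\<alpha> must be of order ln L so that \<alpha> u reaches a large multiple of
      L, while the factor 1/2 keeps \<alpha> e^\<alpha> of smaller order than L.\<close>
    define \<alpha> where "\<alpha> = ln L / 2"
    define u where "u = ln x / ln y"
    define R where "R = \<bar>real (N_count k x y) - x * ((\<Prod>p\<in>primes_upto y. 1 - 1 / real p) *
        coeff (\<Prod>p\<in>primes_upto y. [:1, 1 / (real p - 1):]) k)\<bar>"
    assume x: "x \<ge> 1" and y: "y \<ge> 3" and "real k / ln (ln y) \<le> A" and "ln (ln y) \<ge> max L1 (exp 1)"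
      and "ln x / ln y \<ge> 20 * (ln (ln y) / ln (ln (ln y)))"
    then have rA: "r \<le> A" and LL1: "L \<ge> L1" and Le: "L \<ge> exp 1" and u: "u \<ge> 20 * (L / ln L)"
      by (auto simp: r_def L_def u_def)
    have lny: "ln y \<ge> 1"
      using y by (rule ln_ge_one_if_ge_three)
    have L: "L > 0" "L \<ge> 1"
      using Le exp_ge_add_one_self[of "1::real"] by linarith+
    have lnL: "ln L \<ge> 1"
      using Le L by (subst ln_ge_iff) auto
    have r0: "r \<ge> 0"
      using L by (simp add: r_def)
    have expL: "exp L = ln y"
      using lny by (simp add: L_def)
    have \<alpha>: "0 \<le> \<alpha>" "\<alpha> \<le> ln y"
    proof -
      show "0 \<le> \<alpha>"
        using lnL by (simp add: \<alpha>_def)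
      show "\<alpha> \<le> ln y"
        using ln_le_minus_one[of L] L exp_ge_add_one_self[of L] lnL unfolding \<alpha>_def expL by linarith
    qed
    have \<alpha>u: "\<alpha> * u \<ge> 10 * L"
    proof -
      have "\<alpha> * u \<ge> \<alpha> * (20 * (L / ln L))"
        using u \<alpha> by (intro mult_left_mono) auto
      also have "\<alpha> * (20 * (L / ln L)) = 10 * L"
        using lnL by (simp add: \<alpha>_def)
      finally show ?thesis .
    qed
    have "R * r ^ k \<le> x powr (1 - \<alpha> / ln y) * (\<Prod>p\<in>primes_upto y. 1 + (1 + r) * real p powr (\<alpha> / ln y - 1))"
      using N_count_sieve_error[of x r "\<alpha> / ln y" k y] x r0 \<alpha> lny by (simp add: R_def mult.assoc)
    also have "\<dots> \<le> (x * exp (- \<alpha> * u)) * exp ((1 + r) * (L + K * (1 + \<alpha> * exp \<alpha>)))"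
    proof (intro mult_mono)
      have "x powr (1 - \<alpha> / ln y) = exp (ln x + (- \<alpha> * u))"
        using x by (simp add: powr_def u_def left_diff_distrib)
      then show "x powr (1 - \<alpha> / ln y) \<le> x * exp (- \<alpha> * u)"
        unfolding exp_add using x by simp
      show "(\<Prod>p\<in>primes_upto y. 1 + (1 + r) * real p powr (\<alpha> / ln y - 1)) \<le>
          exp ((1 + r) * (L + K * (1 + \<alpha> * exp \<alpha>)))"
        using K(2)[OF y \<alpha>(1) r0] by (simp add: L_def)
    qed (use x r0 in \<open>auto intro!: prod_nonneg\<close>)
    also have "\<dots> = x * exp (- \<alpha> * u + (1 + r) * (L + K * (1 + \<alpha> * exp \<alpha>)))"
      unfolding exp_add by (simp only: mult.assoc)
    also have "\<dots> \<le> x * exp (real k - 8 * L)"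
    proof -
      have "(1 + r) * (K * (1 + \<alpha> * exp \<alpha>)) \<le> (1 + A) * (K * (1 + \<alpha> * exp \<alpha>))"
        using rA K(1) \<alpha>(1) by (intro mult_right_mono) auto
      also have "\<dots> \<le> L"
        unfolding \<alpha>_def by (rule L1) (rule LL1)
      finally have "(1 + r) * (K * (1 + \<alpha> * exp \<alpha>)) \<le> L" .
      moreover have "(1 + r) * (L + K * (1 + \<alpha> * exp \<alpha>)) = L + r * L + (1 + r) * (K * (1 + \<alpha> * exp \<alpha>))"
        by (simp add: algebra_simps)
      moreover have "r * L = real k"
        using L by (simp add: r_def)
      ultimately have "- \<alpha> * u + (1 + r) * (L + K * (1 + \<alpha> * exp \<alpha>)) \<le> real k - 8 * L"
        using \<alpha>u by linarith
      then show ?thesis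
        using x by (intro mult_left_mono) auto
    qed
    finally have Rr: "R * r ^ k \<le> x * exp (real k - 8 * L)" .
    have "fact k * (R * r ^ k) \<le> (exp 1 * real (max 1 k) * (real k ^ k * exp (- real k))) * (x * exp (real k - 8 * L))"
      using x r0 by (intro mult_mono fact_le_power_exp Rr) (auto simp: R_def)
    also have "\<dots> = real k ^ k * (exp 1 * real (max 1 k) * x * exp (- 8 * L))"
      by (simp add: mult_ac flip: exp_add)
    also have "fact k * (R * r ^ k) = real k ^ k * (fact k * R / L ^ k)"
      by (simp add: r_def power_divide)
    finally have "real k ^ k * (fact k * R / L ^ k) \<le>
        real k ^ k * (exp 1 * real (max 1 k) * x * exp (- 8 * L))" .
    \<comment> \<open>Cancelling k^k instead of r^k treats k = 0 uniformly, since 0^0 = 1.\<close>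
    moreover have "real k ^ k > 0"
      by (cases "k = 0") auto
    ultimately have "fact k * R / L ^ k \<le> exp 1 * real (max 1 k) * x * exp (- 8 * L)"
      by (rule mult_left_le_imp_le)
    then have "R \<le> exp 1 * real (max 1 k) * x * exp (- 8 * L) * (L ^ k / fact k)"
      using L by (simp add: field_simps)
    also have "\<dots> \<le> exp 1 * real (max 1 k) * x * (1 / (L\<^sup>2 * ln y)) * (L ^ k / fact k)"
    proof (intro mult_right_mono mult_left_mono)
      have "L\<^sup>2 \<le> exp L * exp L"
        unfolding power2_eq_square using exp_ge_add_one_self[of L] L by (intro mult_mono) linarith+
      then have "L\<^sup>2 * ln y \<le> exp L * exp L * exp L"
        unfolding expL[symmetric] by (intro mult_right_mono) auto
      also have "\<dots> = exp (3 * L)"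
        by (simp flip: exp_add)
      also have "\<dots> \<le> exp (8 * L)"
        using L by simp
      finally have "1 / exp (8 * L) \<le> 1 / (L\<^sup>2 * ln y)"
        using L lny by (intro divide_left_mono) auto
      then show "exp (- 8 * L) \<le> 1 / (L\<^sup>2 * ln y)"
        by (simp add: exp_minus divide_inverse)
    qed (use x L in auto)
    also have "\<dots> = exp 1 * (real (max 1 k) / L\<^sup>2) * (x * L ^ k / (fact k * ln y))"
      by (simp add: mult_ac)
    finally show "\<bar>real (N_count k x y) - x * ((\<Prod>p\<in>primes_upto y. 1 - 1 / real p) *
        coeff (\<Prod>p\<in>primes_upto y. [:1, 1 / (real p - 1):]) k)\<bar>
      \<le> exp 1 * (real (max 1 k) / (ln (ln y))\<^sup>2) * (x * ln (ln y) ^ k / (fact k * ln y))"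
      by (simp add: R_def L_def)
  qed
qed

text \<open>Converts errors measured against x L^k/(k! ln y) into errors relative to the main
  term.\<close>

lemma main_term_lower_bound:
  assumes "real k / ln (ln y) \<le> A" "y \<ge> 3" "x \<ge> 0"
  shows "exp (- (3 * (A + 1)\<^sup>2 + (A + 1))) * (x * ln (ln y) ^ k / (fact k * ln y)) \<le> main_term x y k"
proof -
  have "ln (ln y) > 0"
    using ln_ln_pos_if_ge_three(1)[OF assms(2)] ln_ln_pos_if_ge_three(2) by linarith
  moreover have "ln y \<ge> 1"
    using assms by (intro ln_ge_one_if_ge_three)
  ultimately show ?thesis
    unfolding main_term_def using main_term_exponent_le[of "real k / ln (ln y)" A] assms
    by (intro mult_right_mono) (auto simp: abs_le_iff)
qed

lemma N_count_asymptotic_large: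
  assumes A: "A \<ge> 1"
  obtains L0 C where "L0 \<ge> exp 1" "C \<ge> 0"
    "\<And>x y k. x \<ge> 1 \<Longrightarrow> y \<ge> 3 \<Longrightarrow> real k / ln (ln y) \<le> A \<Longrightarrow> ln (ln y) \<ge> L0 \<Longrightarrow>
      ln x / ln y \<ge> 20 * (ln (ln y) / ln (ln (ln y))) \<Longrightarrow>
      \<bar>real (N_count k x y) - main_term x y k\<bar> \<le> C * (real (max 1 k) / (ln (ln y))\<^sup>2) * main_term x y k"
proof -
  define f where "f = exp (- (3 * (A + 1)\<^sup>2 + (A + 1)))"
  obtain C1 where C1: "C1 \<ge> 0" and main:
    "\<And>y k. y \<ge> 3 \<Longrightarrow> real k / ln (ln y) \<le> A \<Longrightarrow>
      \<bar>(\<Prod>p\<in>primes_upto y. 1 - 1 / real p) * coeff (\<Prod>p\<in>primes_upto y. [:1, 1 / (real p - 1):]) k -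
        main_term 1 y k\<bar>
      \<le> C1 * (real (max 1 k) / (ln (ln y))\<^sup>2) * (ln (ln y) ^ k / (fact k * ln y))"
    using sieve_main_term[OF A] by blast
  obtain L0 where L0: "L0 \<ge> exp 1" and err:
    "\<And>x y k. x \<ge> 1 \<Longrightarrow> y \<ge> 3 \<Longrightarrow> real k / ln (ln y) \<le> A \<Longrightarrow> ln (ln y) \<ge> L0 \<Longrightarrow>
      ln x / ln y \<ge> 20 * (ln (ln y) / ln (ln (ln y))) \<Longrightarrow>
      \<bar>real (N_count k x y) - x * ((\<Prod>p\<in>primes_upto y. 1 - 1 / real p) *
        coeff (\<Prod>p\<in>primes_upto y. [:1, 1 / (real p - 1):]) k)\<bar>
      \<le> exp 1 * (real (max 1 k) / (ln (ln y))\<^sup>2) * (x * ln (ln y) ^ k / (fact k * ln y))"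
    using sieve_error_term[OF A] by blast
  show ?thesis
  proof
    show "L0 \<ge> exp 1"
      by fact
    show "(exp 1 + C1) / f \<ge> 0"
      using C1 by (simp add: f_def)
    fix x y :: real and k :: nat
    assume x: "x \<ge> 1" and y: "y \<ge> 3" and rA: "real k / ln (ln y) \<le> A" and L: "ln (ln y) \<ge> L0"
      and u: "ln x / ln y \<ge> 20 * (ln (ln y) / ln (ln (ln y)))"
    define q where "q = real (max 1 k) / (ln (ln y))\<^sup>2"
    define T where "T = x * ln (ln y) ^ k / (fact k * ln y)"
    define S where "S = (\<Prod>p\<in>primes_upto y. 1 - 1 / real p) *
        coeff (\<Prod>p\<in>primes_upto y. [:1, 1 / (real p - 1):]) k"
    have "\<bar>x * S - main_term x y k\<bar> = x * \<bar>S - main_term 1 y k\<bar>"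
    proof -
      have "x * S - main_term x y k = x * (S - main_term 1 y k)"
        by (simp add: main_term_def right_diff_distrib)
      then show ?thesis
        using x by (simp add: abs_mult)
    qed
    also have "\<dots> \<le> x * (C1 * q * (ln (ln y) ^ k / (fact k * ln y)))"
      using main[OF y rA] x unfolding q_def S_def by (intro mult_left_mono) auto
    also have "\<dots> = C1 * q * T"
      by (simp add: T_def)
    finally have 1: "\<bar>x * S - main_term x y k\<bar> \<le> C1 * q * T" .
    have 2: "\<bar>real (N_count k x y) - x * S\<bar> \<le> exp 1 * q * T"
      using err[OF x y rA L u] by (simp only: q_def S_def T_def)
    have "\<bar>real (N_count k x y) - main_term x y k\<bar> \<le> (exp 1 + C1) * q * T"
      using 1 2 abs_triangle_ineq[of "real (N_count k x y) - x * S" "x * S - main_term x y k"]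
      by (simp add: distrib_right)
    also have "\<dots> \<le> (exp 1 + C1) * q * (main_term x y k / f)"
    proof (intro mult_left_mono)
      have "f * T \<le> main_term x y k"
        using main_term_lower_bound[OF rA y, of x] x by (simp add: f_def T_def)
      then show "T \<le> main_term x y k / f"
        by (simp add: f_def field_simps)
    qed (use C1 in \<open>auto simp: q_def\<close>)
    finally show "\<bar>real (N_count k x y) - main_term x y k\<bar> \<le>
        (exp 1 + C1) / f * (real (max 1 k) / (ln (ln y))\<^sup>2) * main_term x y k"
      by (simp add: q_def mult_ac)
  qed
qed

lemma N_count_le: "x \<ge> 0 \<Longrightarrow> real (N_count k x y) \<le> x"
proof -
  assume x: "x \<ge> 0"
  have "{n. 1 \<le> n \<and> real n \<le> x \<and> nu n y = k} \<subseteq> {1..nat \<lfloor>x\<rfloor>}"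
    by (auto simp: le_nat_floor)
  then have "N_count k x y \<le> card {1..nat \<lfloor>x\<rfloor>}"
    unfolding N_count_def by (intro card_mono) auto
  then have "real (N_count k x y) \<le> real (nat \<lfloor>x\<rfloor>)"
    by simp
  with x show ?thesis
    by linarith
qed

text \<open>With ln ln y bounded above and below and k at most A L0, the main term is at least c x
  with c > 0, while the count is at most x. Both are thus O(main term), and the error factor is at
  least 1/L0^2; for k = 0 this uses \<open>max 1 k\<close>.\<close>

lemma N_count_asymptotic_small:
  assumes A: "A \<ge> 1" and L0: "L0 \<ge> 1"
  obtains C where "C \<ge> 0"
    "\<And>x y k. x > 0 \<Longrightarrow> y \<ge> 3 \<Longrightarrow> real k / ln (ln y) \<le> A \<Longrightarrow> ln (ln y) \<le> L0 \<Longrightarrow>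
      \<bar>real (N_count k x y) - main_term x y k\<bar> \<le> C * (real (max 1 k) / (ln (ln y))\<^sup>2) * main_term x y k"
proof -
  define f where "f = exp (- (3 * (A + 1)\<^sup>2 + (A + 1)))"
  \<comment> \<open>Capping at 1 makes \<open>m ^ K\<close> at most \<open>m ^ k\<close> for k \<le>
    K, so that one constant covers all k.\<close>
  define m where "m = min 1 (ln (ln (3::real)))"
  define K where "K = nat \<lceil>A * L0\<rceil>"
  define c where "c = f * (m ^ K / (fact K * exp L0))"
  have m: "0 < m" "m \<le> 1"
    using ln_ln_pos_if_ge_three(2) by (auto simp: m_def)
  have c: "c > 0"
    using m by (simp add: c_def f_def)
  show ?thesis
  proof
    show "(1 / c + 1) * L0\<^sup>2 \<ge> 0"
      using c by simp
    fix x y :: real and k :: nat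
    assume x: "x > 0" and y: "y \<ge> 3" and rA: "real k / ln (ln y) \<le> A" and LL0: "ln (ln y) \<le> L0"
    define L where "L = ln (ln y)"
    have mL: "m \<le> L"
      using ln_ln_pos_if_ge_three(1)[OF y] by (simp add: m_def L_def)
    then have L: "L > 0"
      using m by linarith
    have lny: "ln y \<ge> 1"
      using y by (rule ln_ge_one_if_ge_three)
    have "real k \<le> A * L"
      using rA L by (simp add: L_def field_simps)
    also have "\<dots> \<le> A * L0"
      using A LL0 by (intro mult_left_mono) (auto simp: L_def)
    finally have kK: "k \<le> K"
      unfolding K_def by linarith
    have "m ^ K / (fact K * exp L0) \<le> L ^ k / (fact k * ln y)"
    proof (intro frac_le mult_mono)
      have "m ^ K \<le> m ^ k"
        using m kK by (intro power_decreasing) auto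
      also have "\<dots> \<le> L ^ k"
        using m mL by (intro power_mono) auto
      finally show "m ^ K \<le> L ^ k" .
      show "fact k \<le> (fact K :: real)"
        using kK by (rule fact_mono)
      have "exp L \<le> exp L0"
        using LL0 by (simp add: L_def)
      then show "ln y \<le> exp L0"
        using lny by (simp add: L_def)
    qed (use lny L in auto)
    then have "(x * f) * (m ^ K / (fact K * exp L0)) \<le> (x * f) * (L ^ k / (fact k * ln y))"
      using x by (intro mult_left_mono) (auto simp: f_def)
    then have "c * x \<le> f * (x * L ^ k / (fact k * ln y))"
      by (simp add: c_def mult_ac)
    also have "\<dots> \<le> main_term x y k"
      using main_term_lower_bound[OF rA y, of x] x by (simp add: f_def L_def)
    finally have M: "c * x \<le> main_term x y k" .
    then have xM: "x \<le> main_term x y k / c"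
      using c by (simp add: field_simps)
    have M0: "main_term x y k > 0"
      using M c x by (meson less_le_trans mult_pos_pos)
    have "\<bar>real (N_count k x y) - main_term x y k\<bar> \<le> x + main_term x y k"
      using N_count_le[of x k y] x M0 by linarith
    also have "\<dots> \<le> (1 / c + 1) * main_term x y k"
      using xM by (simp add: distrib_right)
    also have "\<dots> \<le> (1 / c + 1) * (L0\<^sup>2 * (real (max 1 k) / L\<^sup>2)) * main_term x y k"
    proof (intro mult_right_mono)
      have "1 * L\<^sup>2 \<le> real (max 1 k) * L0\<^sup>2"
        using LL0 L by (intro mult_mono power_mono) (auto simp: L_def)
      then have "1 \<le> L0\<^sup>2 * (real (max 1 k) / L\<^sup>2)"
        using L by (simp add: field_simps)
      then show "1 / c + 1 \<le> (1 / c + 1) * (L0\<^sup>2 * (real (max 1 k) / L\<^sup>2))"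
        using c mult_left_mono[of 1 "L0\<^sup>2 * (real (max 1 k) / L\<^sup>2)" "1 / c + 1"] by simp
    qed (use M0 in auto)
    finally show "\<bar>real (N_count k x y) - main_term x y k\<bar> \<le>
        (1 / c + 1) * L0\<^sup>2 * (real (max 1 k) / (ln (ln y))\<^sup>2) * main_term x y k"
      by (simp add: L_def mult_ac)
  qed
qed

text \<open>The hypothesis bounds ln x/ln y below by 20 w/ln w with w = ln ln x. Passing from w to
  the smaller L = ln ln y uses that t/ln t increases for t \<ge> e, which is where L \<ge> e
  enters.\<close>

lemma ln_ratio_lower_bound:
  fixes x y :: real
  assumes x: "x > exp (exp 1)" and y: "y \<ge> 3" and le: "y \<le> x powr (1 / 20 * ln (ln (ln x)) / ln (ln x))"
    and L: "ln (ln y) \<ge> exp 1"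
  shows "ln x / ln y \<ge> 20 * (ln (ln y) / ln (ln (ln y)))"
proof -
  define w where "w = ln (ln x)"
  define L where "L = ln (ln y)"
  have x0: "x > 0"
    using x exp_gt_zero less_trans by blast
  have "ln x > exp 1"
    using x x0 by (metis exp_gt_zero ln_exp ln_less_cancel_iff)
  then have lnx: "ln x > 0"
    using exp_gt_zero[of "1::real"] by linarith
  then have w: "w > 1"
    using \<open>ln x > exp 1\<close> ln_less_cancel_iff[of "exp 1" "ln x"] by (simp add: w_def)
  have lny: "ln y \<ge> 1"
    using y by (rule ln_ge_one_if_ge_three)
  have "ln y \<le> ln (x powr (1 / 20 * ln w / w))"
    using le y by (intro ln_mono) (auto simp: w_def)
  also have "\<dots> = ln x * (ln w / (20 * w))"
    using x0 by (simp add: ln_powr)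
  finally have lny_le: "ln y \<le> ln x * (ln w / (20 * w))" .
  have lnw: "ln w > 0" "ln w \<le> w"
    using w ln_le_minus_one[of w] by auto
  have "ln w / (20 * w) \<le> 1"
    using lnw w by simp
  then have "ln x * (ln w / (20 * w)) \<le> ln x * 1"
    using lnx by (intro mult_left_mono) auto
  with lny_le have "ln y \<le> ln x"
    by linarith
  then have Lw: "L \<le> w"
    unfolding L_def w_def using lny by (intro ln_mono[of "ln y"]) auto
  have L0: "L > 0" and lnL: "ln L \<ge> 1"
  proof -
    show "L > 0"
      using L exp_gt_zero[of "1::real"] unfolding L_def by linarith
    then show "ln L \<ge> 1"
      using L by (subst ln_ge_iff) (auto simp: L_def)
  qed
  \<comment> \<open>Monotonicity of t/ln t without derivatives: ln(w/L) \<le> w/L - 1 \<le> (w/L -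
    1) ln L because ln L \<ge> 1.\<close>
  have "ln w = ln L + ln (w / L)"
    using L0 w by (simp add: ln_div)
  also have "ln (w / L) \<le> (w / L - 1) * 1"
    using L0 w ln_le_minus_one[of "w / L"] by simp
  also have "(w / L - 1) * 1 \<le> (w / L - 1) * ln L"
    using L0 Lw lnL by (intro mult_left_mono) auto
  finally have "ln w \<le> w / L * ln L"
    by (simp add: left_diff_distrib)
  then have "L / ln L \<le> w / ln w"
    using L0 less_le_trans[OF zero_less_one lnL] lnw by (simp add: field_simps)
  then have "20 * (L / ln L) \<le> 20 * w / ln w"
    by simp
  also have "\<dots> \<le> ln x / ln y"
    using lny_le less_le_trans[OF zero_less_one lny] lnw w by (simp add: field_simps)
  finally show ?thesis
    by (simp add: L_def)
qed

text \<open>\<open>E\<close> is the O-term, and x > e^e makes the threefold logarithm of x positive.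
  At k = 0 an error bound proportional to k would force E = 0, which cannot hold throughout: the
  count is an integer while e^(-\<gamma>) x/ln y varies continuously with x. Hence
  \<open>max 1 k\<close>, which agrees with k for k \<ge> 1.\<close>

theorem theorem1p1:
  "\<exists>c::real. c > 0 \<and> (\<forall>A::real. A > 0 \<longrightarrow> (\<exists>C::real. C > 0 \<and>
     (\<forall>(x::real) (y::real) (k::nat) (r::real).
        x > exp (exp 1) \<longrightarrow>
        3 \<le> y \<longrightarrow>
        y \<le> x powr (c * iter_ln 3 x / iter_ln 2 x) \<longrightarrow>
        r = real k / iter_ln 2 y \<longrightarrow>
        r \<le> A \<longrightarrow>
        (\<exists>E::real. \<bar>E\<bar> \<le> C * (real (max 1 k) / (iter_ln 2 y)\<^sup>2) \<and>
           complex_of_real (real (N_count k x y)) =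
             F (complex_of_real r) *
             complex_of_real (exp (euler_mascheroni * (r - 1)) *
               (x * iter_ln 2 y ^ k / (fact k * ln y)) * (1 + E))))))"
proof (rule exI[of _ "1 / 20"], intro conjI allI impI)
  have iter: "iter_ln 2 t = ln (ln t)" "iter_ln 3 t = ln (ln (ln t))" for t
    by (simp_all add: iter_ln_def numeral_2_eq_2 numeral_3_eq_3)
  fix A :: real
  \<comment> \<open>The estimates are stated for bounds at least 1; enlarging A costs nothing since
    c does not depend on it.\<close>
  define A1 where "A1 = max 1 A"
  have A1: "A1 \<ge> 1" "A \<le> A1"
    by (auto simp: A1_def)
  obtain L0 C1 where L0: "L0 \<ge> exp 1" and C1: "C1 \<ge> 0" and large:
    "\<And>x y k. x \<ge> 1 \<Longrightarrow> y \<ge> 3 \<Longrightarrow> real k / ln (ln y) \<le> A1 \<Longrightarrow> ln (ln y) \<ge> L0 \<Longrightarrow>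
      ln x / ln y \<ge> 20 * (ln (ln y) / ln (ln (ln y))) \<Longrightarrow>
      \<bar>real (N_count k x y) - main_term x y k\<bar> \<le> C1 * (real (max 1 k) / (ln (ln y))\<^sup>2) * main_term x y k"
    using N_count_asymptotic_large[OF A1(1)] by blast
  have "L0 \<ge> 1"
    using L0 exp_ge_add_one_self[of "1::real"] by linarith
  then obtain C2 where C2: "C2 \<ge> 0" and small:
    "\<And>x y k. x > 0 \<Longrightarrow> y \<ge> 3 \<Longrightarrow> real k / ln (ln y) \<le> A1 \<Longrightarrow> ln (ln y) \<le> L0 \<Longrightarrow>
      \<bar>real (N_count k x y) - main_term x y k\<bar> \<le> C2 * (real (max 1 k) / (ln (ln y))\<^sup>2) * main_term x y k"
    using N_count_asymptotic_small[OF A1(1)] by blast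
  define C where "C = C1 + C2 + 1"
  show "\<exists>C::real. C > 0 \<and>
     (\<forall>(x::real) (y::real) (k::nat) (r::real).
        x > exp (exp 1) \<longrightarrow>
        3 \<le> y \<longrightarrow>
        y \<le> x powr (1 / 20 * iter_ln 3 x / iter_ln 2 x) \<longrightarrow>
        r = real k / iter_ln 2 y \<longrightarrow>
        r \<le> A \<longrightarrow>
        (\<exists>E::real. \<bar>E\<bar> \<le> C * (real (max 1 k) / (iter_ln 2 y)\<^sup>2) \<and>
           complex_of_real (real (N_count k x y)) =
             F (complex_of_real r) *
             complex_of_real (exp (euler_mascheroni * (r - 1)) *
               (x * iter_ln 2 y ^ k / (fact k * ln y)) * (1 + E))))"
    unfolding iter
  proof (rule exI[of _ C], intro conjI allI impI)
    show "C > 0"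
      using C1 C2 by (simp add: C_def)
    fix x y :: real and k :: nat and r :: real
    assume x: "x > exp (exp 1)" and y: "3 \<le> y" and le: "y \<le> x powr (1 / 20 * ln (ln (ln x)) / ln (ln x))"
      and r: "r = real k / ln (ln y)" and rA: "r \<le> A"
    define M where "M = main_term x y k"
    define E where "E = real (N_count k x y) / M - 1"
    define q where "q = real (max 1 k) / (ln (ln y))\<^sup>2"
    have x1: "x \<ge> 1"
      using x one_le_exp_iff[of "exp (1::real)"] exp_ge_zero[of "1::real"] by linarith
    have L: "ln (ln y) > 0"
      using ln_ln_pos_if_ge_three(1)[OF y] ln_ln_pos_if_ge_three(2) by linarith
    have lny: "ln y \<ge> 1"
      using y by (rule ln_ge_one_if_ge_three)
    have M: "M > 0"
      using x1 L lny by (simp add: M_def main_term_def)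
    have q: "q \<ge> 0"
      by (simp add: q_def)
    have rA1: "real k / ln (ln y) \<le> A1"
      using r rA A1 by simp
    have "\<bar>real (N_count k x y) - M\<bar> \<le> C * q * M"
    proof (cases "ln (ln y) \<ge> L0")
      case True
      then have "ln x / ln y \<ge> 20 * (ln (ln y) / ln (ln (ln y)))"
        using L0 by (intro ln_ratio_lower_bound[OF x y le]) auto
      from large[OF x1 y rA1 True this] have "\<bar>real (N_count k x y) - M\<bar> \<le> C1 * q * M"
        by (simp only: M_def q_def)
      also have "\<dots> \<le> C * q * M"
        using C2 q M by (intro mult_right_mono) (auto simp: C_def)
      finally show ?thesis .
    next
      case False
      have "\<bar>real (N_count k x y) - M\<bar> \<le> C2 * q * M"
        using small[OF _ y rA1, of x] x1 False by (simp only: M_def q_def)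
      also have "\<dots> \<le> C * q * M"
        using C1 q M by (intro mult_right_mono) (auto simp: C_def)
      finally show ?thesis .
    qed
    moreover have "E = (real (N_count k x y) - M) / M"
      using M by (simp add: E_def field_simps)
    ultimately have "\<bar>E\<bar> \<le> C * q"
      using M by (simp add: abs_divide pos_divide_le_eq)
    moreover have "real (N_count k x y) = exp (log_F r) *
        (exp (euler_mascheroni * (r - 1)) * (x * ln (ln y) ^ k / (fact k * ln y)) * (1 + E))"
    proof -
      have "M = exp (log_F r) * exp (euler_mascheroni * (r - 1)) * (x * ln (ln y) ^ k / (fact k * ln y))"
        unfolding M_def main_term_def r exp_add ..
      moreover have "real (N_count k x y) = M * (1 + E)"
        using M by (simp add: E_def)
      ultimately show ?thesis
        by (simp only: mult.assoc)
    qed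
    moreover have "r \<ge> 0"
      using L by (simp add: r)
    ultimately show "\<exists>E::real. \<bar>E\<bar> \<le> C * (real (max 1 k) / (ln (ln y))\<^sup>2) \<and>
        complex_of_real (real (N_count k x y)) = F (complex_of_real r) *
          complex_of_real (exp (euler_mascheroni * (r - 1)) *
            (x * ln (ln y) ^ k / (fact k * ln y)) * (1 + E))"
      unfolding q_def F_of_real_eq[OF \<open>r \<ge> 0\<close>] of_real_mult[symmetric] of_real_eq_iff by blast
  qed
qed simp

end
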